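(* Let $c\ge1$ be an integer. For every $n\ge 1$ and all non-negative integers $n_0,\ldots,n_c$ with $n_0+\cdots+n_c=n$, the irreducible $\mathbb{C}P_{n,c}$-module $W^n_{n_0,\ldots,n_c}$, regarded as a $\mathbb{C}P_{n-1,c}$-module via the embedding $\gamma:\mathbb{C}P_{n-1,c}\to\mathbb{C}P_{n,c}$, decomposes into irreducible $\mathbb{C}P_{n-1,c}$-modules as $$W^n_{n_0,\ldots,n_c}\cong\bigoplus_{\substack{0\le j\le c\\ n_j\neq0}}W^{n-1}_{n_0,\ldots,n_j-1,\ldots,n_c}.$$ Consequently the Bratteli diagram of the tower $\mathbb{C}P_{0,c}\subseteq\mathbb{C}P_{1,c}\subseteq\mathbb{C}P_{2,c}\subseteq\cdots$ is Pascal's $(c+1)$-simplex: its level-$n$ vertices are the $W^n_{n_0,\ldots,n_c}$ with $n_0+\cdots+n_c=n$; $W^n_{n_0,\ldots,n_c}$ and $W^{n-1}_{m_0,\ldots,m_c}$ are adjacent if and only if $(m_0,\ldots,m_c)$ is obtained from $(n_0,\ldots,n_c)$ by decreasing exactly one entry by $1$; and the dimension of the vertex $W^n_{n_0,\ldots,n_c}$ is $\binom{n}{n_0,\ldots,n_c}$.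
   Context: Fix colors $u_1,\ldots,u_c$. For $n\ge1$, $P_{n,c}$ is the set of diagrams consisting of a top row and a bottom row of $n$ vertices (each row numbered $1,\ldots,n$) together with edges, each joining a top vertex to a bottom vertex and colored with one of the $c$ colors, such that each vertex is incident to at most one edge and no two edges of the same color cross (if top $i$–bottom $j$ and top $i'$–bottom $j'$ are edges of the same color with $i<i'$, then $j<j'$). $P_{0,c}=\{\emptyset\}$ consists of the single empty diagram. The product $d_1d_2$ is obtained by stacking $d_1$ on top of $d_2$, identifying the bottom vertices of $d_1$ with the top vertices of $d_2$; the edges of $d_1d_2$ are exactly the monochromatic paths from the top of $d_1$ to the bottom of $d_2$ (with that color). This makes $P_{n,c}$ a semigroup. $\mathbb{C}P_{n,c}$ is the $\mathbb{C}$-algebra with basis $P_{n,c}$ and multiplication extended bilinearly; it is associative and unital. For $d\in P_{n,c}$, $\mathrm{size}(d)$ is the number of edges of $d$. Write $d'\subseteq d$ if every edge of $d'$ is an edge of $d$ with the same color. Set $x_d=\sum_{d'\subseteq d}(-1)^{\mathrm{size}(d)-\mathrm{size}(d')}d'$. Let $\beta(d)=(\beta_0(d),\ldots,\beta_c(d))$, where $\beta_0(d)$ is the set of isolated bottom vertices and, for $1\le i\le c$, $\beta_i(d)$ is the set of bottom vertices incident to an edge colored $u_i$. Let $X_n=\{\beta(d)\mid d\in P_{n,c}\}$, and write $T=(T_0,\ldots,T_c)$ for $T\in X_n$. For $T\in X_n$ let $W^n_T=\mathbb{C}\text{-span}\{x_a\mid a\in P_{n,c},\ \beta(a)=T\}$,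 an irreducible $\mathbb{C}P_{n,c}$-module under left multiplication. The modules $W^n_T$ and $W^n_S$ are isomorphic if and only if $|T_i|=|S_i|$ for all $i$, and $W^n_{n_0,\ldots,n_c}$ denotes a representative of the isomorphism class of the $W^n_T$ with $|T_i|=n_i$ for all $i\in\{0,\ldots,c\}$; these modules form a complete set of irreducible $\mathbb{C}P_{n,c}$-modules up to isomorphism. Embedding: let $I_i\in P_{1,c}$ ($1\le i\le c$) be the single vertical edge colored $u_i$ and $I_0\in P_{1,c}$ the pair of isolated vertices. For $d\in P_{n-1,c}$, $d\otimes I_i\in P_{n,c}$ is $d$ with $I_i$ concatenated on the right, extended linearly to $g\otimes I_i$ for $g\in\mathbb{C}P_{n-1,c}$. The embedding is $\gamma(g)=\left(\sum_{i=1}^c g\otimes I_i\right)-(c-1)(g\otimes I_0)$, and $\mathbb{C}P_{n-1,c}$ acts on $\mathbb{C}P_{n,c}$-modules through $\gamma$. Bratteli diagram: the graph whose vertex set is $\bigcup_{n\ge0}\{W^n_{n_0,\ldots,n_c}\mid n_0+\cdots+n_c=n\}$ ($n$ being the level), with an edge between $W^n_{n_0,\ldots,n_c}$ and $W^{n-1}_{m_0,\ldots,m_c}$ if and only if the latter is isomorphic to one of the summands in the decomposition of $W^n_{n_0,\ldots,n_c}$ into irreducible $\mathbb{C}P_{n-1,c}$-modules. *)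

theory Defs
  imports Complex_Main "HOL-Library.Poly_Mapping" "HOL-Algebra.Module" "HOL-Algebra.Product_Groups"
begin

section \<open>Left modules over a ring that need not be commutative\<close>

text \<open>The locale for modules in \<open>HOL-Algebra.Module\<close> asks for a commutative ring, so its axioms
  are restated over an arbitrary ring; as there, the fields \<open>mult\<close> and \<open>one\<close> of a module record
  carry no meaning. The records and the notion of submodule are the library's.\<close>

locale left_module = R?: ring R + M?: abelian_group M
  for R :: "('a, 'm) ring_scheme" (structure) and M :: "('a, 'b, 'n) module_scheme" (structure) +
  assumes smult_closed:
      "\<lbrakk>a \<in> carrier R; x \<in> carrier M\<rbrakk> \<Longrightarrow> a \<odot>\<^bsub>M\<^esub> x \<in> carrier M"
    and smult_l_distr:
      "\<lbrakk>a \<in> carrier R; b \<in> carrier R; x \<in> carrier M\<rbrakk> \<Longrightarrow>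
        (a \<oplus>\<^bsub>R\<^esub> b) \<odot>\<^bsub>M\<^esub> x = a \<odot>\<^bsub>M\<^esub> x \<oplus>\<^bsub>M\<^esub> b \<odot>\<^bsub>M\<^esub> x"
    and smult_r_distr:
      "\<lbrakk>a \<in> carrier R; x \<in> carrier M; y \<in> carrier M\<rbrakk> \<Longrightarrow>
        a \<odot>\<^bsub>M\<^esub> (x \<oplus>\<^bsub>M\<^esub> y) = a \<odot>\<^bsub>M\<^esub> x \<oplus>\<^bsub>M\<^esub> a \<odot>\<^bsub>M\<^esub> y"
    and smult_assoc:
      "\<lbrakk>a \<in> carrier R; b \<in> carrier R; x \<in> carrier M\<rbrakk> \<Longrightarrow>
        (a \<otimes>\<^bsub>R\<^esub> b) \<odot>\<^bsub>M\<^esub> x = a \<odot>\<^bsub>M\<^esub> (b \<odot>\<^bsub>M\<^esub> x)"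
    and smult_one:
      "x \<in> carrier M \<Longrightarrow> \<one>\<^bsub>R\<^esub> \<odot>\<^bsub>M\<^esub> x = x"

definition irreducible_module ::
    "('a, 'm) ring_scheme \<Rightarrow> ('a, 'b, 'n) module_scheme \<Rightarrow> bool" where
  "irreducible_module R M \<longleftrightarrow>
     left_module R M \<and> carrier M \<noteq> {\<zero>\<^bsub>M\<^esub>} \<and>
     (\<forall>H. submodule H R M \<longrightarrow> H = {\<zero>\<^bsub>M\<^esub>} \<or> H = carrier M)"

definition isomorphic_modules ::
    "('a, 'm) ring_scheme \<Rightarrow> ('a, 'b, 'n) module_scheme \<Rightarrow> ('a, 'd, 'k) module_scheme \<Rightarrow> bool" where
  "isomorphic_modules R M N \<longleftrightarrow>
     left_module R M \<and> left_module R N \<and>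
     (\<exists>\<phi> \<in> iso (add_monoid M) (add_monoid N).
        \<forall>a \<in> carrier R. \<forall>x \<in> carrier M. \<phi> (a \<odot>\<^bsub>M\<^esub> x) = a \<odot>\<^bsub>N\<^esub> \<phi> x)"

definition direct_sum :: "'i set \<Rightarrow> ('i \<Rightarrow> ('a, 'b) module) \<Rightarrow> ('a, 'i \<Rightarrow> 'b) module" where
  "direct_sum I N =
     \<lparr>carrier = carrier (sum_group I (\<lambda>i. add_monoid (N i))),
      monoid.mult = undefined, one = undefined,
      zero = \<one>\<^bsub>sum_group I (\<lambda>i. add_monoid (N i))\<^esub>,
      add = (\<lambda>x y. x \<otimes>\<^bsub>sum_group I (\<lambda>i. add_monoid (N i))\<^esub> y),
      smult = (\<lambda>a x. \<lambda>i\<in>I. a \<odot>\<^bsub>N i\<^esub> x i)\<rparr>"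

definition decomposes_into_irreducibles ::
    "('a, 'm) ring_scheme \<Rightarrow> ('a, 'b) module \<Rightarrow> 'i set \<Rightarrow> ('i \<Rightarrow> ('a, 'd) module) \<Rightarrow> bool" where
  "decomposes_into_irreducibles R M I N \<longleftrightarrow>
     finite I \<and> (\<forall>i\<in>I. irreducible_module R (N i)) \<and> isomorphic_modules R M (direct_sum I N)"

definition restrict_scalars :: "('a \<Rightarrow> 'a) \<Rightarrow> ('a, 'b) module \<Rightarrow> ('a, 'b) module" where
  "restrict_scalars \<gamma> M = M\<lparr>smult := (\<lambda>a x. \<gamma> a \<odot>\<^bsub>M\<^esub> x)\<rparr>"


section \<open>Coloured diagrams\<close>

text \<open>The triple \<open>(i, j, a)\<close> is the edge from top vertex \<open>i\<close> to bottom vertex \<open>j\<close> with the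
  \<open>a\<close>-th colour, \<open>1 \<le> a \<le> c\<close>. The vertex count \<open>n\<close> is not recorded in the edge set, so every
  notion that involves isolated vertices takes it as a parameter.\<close>

type_synonym diagram = "(nat \<times> nat \<times> nat) set"

definition diagrams :: "nat \<Rightarrow> nat \<Rightarrow> diagram set" where
  "diagrams c n =
     {d. d \<subseteq> {1..n} \<times> {1..n} \<times> {1..c} \<and>
         (\<forall>(i, j, a) \<in> d. \<forall>(i', j', a') \<in> d. i = i' \<or> j = j' \<longrightarrow> (i, j, a) = (i', j', a')) \<and>
         (\<forall>(i, j, a) \<in> d. \<forall>(i', j', a') \<in> d. a = a' \<and> i < i' \<longrightarrow> j < j')}"

definition stack :: "diagram \<Rightarrow> diagram \<Rightarrow> diagram" where
  "stack d1 d2 = {(i, k, a). \<exists>j. (i, j, a) \<in> d1 \<and> (j, k, a) \<in> d2}"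

definition concat_right :: "nat \<Rightarrow> diagram \<Rightarrow> diagram \<Rightarrow> diagram" where
  "concat_right m d e = d \<union> (\<lambda>(i, j, a). (m + i, m + j, a)) ` e"

definition one_column :: "nat \<Rightarrow> diagram" where
  "one_column i = (if i = 0 then {} else {(1, 1, i)})"

definition bottom_type :: "nat \<Rightarrow> diagram \<Rightarrow> nat \<Rightarrow> nat set" where
  "bottom_type n d i =
     (if i = 0 then {j \<in> {1..n}. \<not> (\<exists>t a. (t, j, a) \<in> d)} else {j. \<exists>t. (t, j, i) \<in> d})"

definition bottom_types :: "nat \<Rightarrow> nat \<Rightarrow> (nat \<Rightarrow> nat set) set" where
  "bottom_types c n = bottom_type n ` diagrams c n"


section \<open>The diagram algebra\<close>

type_synonym comb = "diagram \<Rightarrow>\<^sub>0 complex"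

definition cscale :: "complex \<Rightarrow> comb \<Rightarrow> comb" where
  "cscale z f = Poly_Mapping.map (\<lambda>w. z * w) f"

lemma lookup_cscale [simp]:
  "Poly_Mapping.lookup (cscale z f) d = z * Poly_Mapping.lookup f d"
  by (simp add: cscale_def Poly_Mapping.map.rep_eq when_def)

interpretation comb: vector_space cscale
  by unfold_locales (auto intro!: poly_mapping_eqI simp: lookup_add algebra_simps)

definition comb_mult :: "comb \<Rightarrow> comb \<Rightarrow> comb" where
  "comb_mult f g =
     (\<Sum>d1 \<in> Poly_Mapping.keys f. \<Sum>d2 \<in> Poly_Mapping.keys g.
        Poly_Mapping.single (stack d1 d2) (Poly_Mapping.lookup f d1 * Poly_Mapping.lookup g d2))"

definition diagram_carrier :: "nat \<Rightarrow> nat \<Rightarrow> comb set" where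
  "diagram_carrier c n = {f. Poly_Mapping.keys f \<subseteq> diagrams c n}"

text \<open>For \<open>c \<ge> 2\<close> and \<open>n \<ge> 1\<close> the identity is not a single diagram.\<close>

definition diagram_algebra :: "nat \<Rightarrow> nat \<Rightarrow> comb ring" where
  "diagram_algebra c n =
     \<lparr>carrier = diagram_carrier c n,
      monoid.mult = comb_mult,
      one = (THE e. e \<in> diagram_carrier c n \<and>
                    (\<forall>f \<in> diagram_carrier c n. comb_mult e f = f \<and> comb_mult f e = f)),
      zero = 0,
      add = (+)\<rparr>"

definition comb_concat :: "nat \<Rightarrow> comb \<Rightarrow> diagram \<Rightarrow> comb" where
  "comb_concat m g e =
     (\<Sum>d \<in> Poly_Mapping.keys g.
        Poly_Mapping.single (concat_right m d e) (Poly_Mapping.lookup g d))"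

text \<open>\<open>embedding c m\<close> maps \<open>diagram_algebra c m\<close> into \<open>diagram_algebra c (m + 1)\<close>.\<close>

definition embedding :: "nat \<Rightarrow> nat \<Rightarrow> comb \<Rightarrow> comb" where
  "embedding c m g =
     (\<Sum>i = 1..c. comb_concat m g (one_column i)) -
     cscale (of_nat c - 1) (comb_concat m g (one_column 0))"


section \<open>The irreducible modules\<close>

definition alternating :: "diagram \<Rightarrow> comb" where
  "alternating d = (\<Sum>d' \<in> Pow d. Poly_Mapping.single d' ((-1) ^ (card d - card d')))"

definition module_of_type :: "nat \<Rightarrow> nat \<Rightarrow> (nat \<Rightarrow> nat set) \<Rightarrow> (comb, comb) module" where
  "module_of_type c n T =
     \<lparr>carrier = comb.span {alternating a | a. a \<in> diagrams c n \<and> bottom_type n a = T},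
      monoid.mult = undefined, one = undefined,
      zero = 0,
      add = (+),
      smult = comb_mult\<rparr>"

text \<open>A tuple \<open>(n\<^sub>0, \<dots>, n\<^sub>c)\<close> is a function that vanishes above \<open>c\<close>, so that distinct functions
  are distinct tuples.\<close>

definition compositions :: "nat \<Rightarrow> nat \<Rightarrow> (nat \<Rightarrow> nat) set" where
  "compositions c n = {ns. (\<forall>i>c. ns i = 0) \<and> (\<Sum>i\<le>c. ns i) = n}"

definition irrep :: "nat \<Rightarrow> nat \<Rightarrow> (nat \<Rightarrow> nat) \<Rightarrow> (comb, comb) module" where
  "irrep c n ns =
     module_of_type c n (SOME T. T \<in> bottom_types c n \<and> (\<forall>i\<le>c. card (T i) = ns i))"

definition multinomial :: "nat \<Rightarrow> (nat \<Rightarrow> nat) \<Rightarrow> nat" where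
  "multinomial c ns = fact (\<Sum>i\<le>c. ns i) div (\<Prod>i\<le>c. fact (ns i))"


section \<open>The Bratteli diagram\<close>

text \<open>Vertices are tagged with their level because equal subspaces can occur at several levels:
  the span of the empty edge set is the module of the tuple \<open>(n, 0, \<dots>, 0)\<close> for every \<open>n\<close>.\<close>

type_synonym bratteli_vertex = "nat \<times> (comb, comb) module"

definition bratteli_vertices :: "nat \<Rightarrow> bratteli_vertex set" where
  "bratteli_vertices c = (\<Union>n. {(n, irrep c n ns) | ns. ns \<in> compositions c n})"

definition is_summand :: "nat \<Rightarrow> nat \<Rightarrow> (comb, comb) module \<Rightarrow> (comb, comb) module \<Rightarrow> bool" where
  "is_summand c m U V \<longleftrightarrow>
     (\<exists>(I :: nat set) (N :: nat \<Rightarrow> (comb, comb) module).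
        decomposes_into_irreducibles (diagram_algebra c m)
          (restrict_scalars (embedding c m) V) I N \<and>
        (\<exists>i\<in>I. isomorphic_modules (diagram_algebra c m) U (N i)))"

definition bratteli_edges :: "nat \<Rightarrow> bratteli_vertex set set" where
  "bratteli_edges c =
     {{(n, V), (n - 1, U)} | n V U.
        n \<ge> 1 \<and> (n, V) \<in> bratteli_vertices c \<and> (n - 1, U) \<in> bratteli_vertices c \<and>
        is_summand c (n - 1) U V}"

end

theory Submission
  imports Defs
begin

text \<open>A diagram is determined by its top type \<open>S\<close> and its bottom type \<open>T\<close>, and every pair of
  types with the same cardinalities occurs. Write \<open>E S T\<close> for the vector \<open>x\<^sub>d\<close> of that diagram.
  Cancellation in the alternating sums gives \<open>E S T \<cdot> E S' T' = E S T'\<close> if \<open>T = S'\<close> and \<open>0\<close>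
  otherwise, so the algebra is a sum of matrix algebras, one for each tuple, and the modules are
  its columns. In this basis the embedding becomes
  \<open>E S T \<mapsto> \<Sum>\<^sub>j E (S + j) (T + j)\<close>, where \<open>S + j\<close> gives the new vertex the colour \<open>j\<close>. Hence the
  column of \<open>T\<close> splits according to the colour of the last top vertex. A summand of type \<open>m\<close>
  is detected by the idempotent \<open>E S S\<close> with \<open>S\<close> of type \<open>m\<close>, so no uniqueness theorem for
  decompositions is needed.\<close>

section \<open>Diagrams and their boundary types\<close>

text \<open>The signs in \<open>alternating\<close> form the Moebius function of the inclusion
  order. An edge that meets no edge of its own colour in the other factor can therefore be inserted
  or removed without changing a product, and its terms cancel in pairs; orthogonality comes from
  this. The second index of \<open>E S T\<close> is inert under left multiplication. This matters
  because the representatives of the isomorphism classes are chosen independently at each level: the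
  type chosen for m vertices need not be the type chosen for m + 1 vertices with its last vertex
  removed, so only cardinalities can be compared. The coefficient c - 1 in the embedding has the
  following origin. Attaching a vertical edge to \<open>E S T\<close> yields the wanted matrix unit
  plus a spare copy of \<open>E S T\<close>, once for each of the c colours. Exactly one spare copy
  has to survive, to serve as the matrix unit in which the new vertex is isolated; a diagram being a
  bare edge set, that matrix unit is literally \<open>E S T\<close> again.\<close>

definition rank :: "nat set \<Rightarrow> nat \<Rightarrow> nat" where
  "rank A x = card {y \<in> A. y < x}"

lemma rank_less:
  assumes "finite A" "x \<in> A" "x < y"
  shows "rank A x < rank A y"
  unfolding rank_def using assms by (intro psubset_card_mono) auto

lemma rank_less_iff:
  assumes "finite A" "x \<in> A" "y \<in> A"
  shows "rank A x < rank A y \<longleftrightarrow> x < y"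
  by (metis assms linorder_neqE_nat nat_less_le order_less_asym rank_less)

lemma rank_eq_iff:
  assumes "finite A" "x \<in> A" "y \<in> A"
  shows "rank A x = rank A y \<longleftrightarrow> x = y"
  by (metis assms linorder_neqE_nat nat_less_le rank_less)

text \<open>Ranks count from 0 without gaps, so finite sets of equal size have the same ranks. This
  is what lets equal cardinalities match all vertices of a colour.\<close>

lemma rank_image:
  assumes "finite A"
  shows "rank A ` A = {..<card A}"
proof (rule card_subset_eq)
  show "rank A ` A \<subseteq> {..<card A}"
    unfolding rank_def using assms by (auto intro!: psubset_card_mono)
  show "card (rank A ` A) = card {..<card A}"
    using assms by (simp add: card_image inj_on_def rank_eq_iff)
qed simp

text \<open>A description of the bottom types that mentions no diagram: labelled partitions of the
  vertices, with label 0 for the isolated ones. Emptiness above \<open>c\<close> makes equal tuples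
  equal functions.\<close>

definition colour_types :: "nat \<Rightarrow> nat \<Rightarrow> (nat \<Rightarrow> nat set) set" where
  "colour_types c n =
     {T. (\<forall>i>c. T i = {}) \<and> (\<Union>i\<le>c. T i) = {1..n} \<and> (\<forall>i j. i \<noteq> j \<longrightarrow> T i \<inter> T j = {})}"

definition same_shape :: "(nat \<Rightarrow> nat set) \<Rightarrow> (nat \<Rightarrow> nat set) \<Rightarrow> bool" where
  "same_shape S T \<longleftrightarrow> (\<forall>i. card (S i) = card (T i))"

text \<open>Edges of one colour do not cross, so they match vertices of equal rank.\<close>

definition type_diagram :: "(nat \<Rightarrow> nat set) \<Rightarrow> (nat \<Rightarrow> nat set) \<Rightarrow> diagram" where
  "type_diagram S T =
     {(i, j, a). a \<noteq> 0 \<and> i \<in> S a \<and> j \<in> T a \<and> rank (S a) i = rank (T a) j}"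

text \<open>Reflection in a horizontal line. Expressing top types through it lets facts on the
  bottom row serve for the top row too.\<close>

definition flip :: "diagram \<Rightarrow> diagram" where
  "flip d = {(j, i, a). (i, j, a) \<in> d}"

abbreviation top_type :: "nat \<Rightarrow> diagram \<Rightarrow> nat \<Rightarrow> nat set" where
  "top_type n d \<equiv> bottom_type n (flip d)"

lemma in_flip [simp]: "(j, i, a) \<in> flip d \<longleftrightarrow> (i, j, a) \<in> d"
  by (simp add: flip_def)

lemma same_shape_refl [simp]: "same_shape S S"
  by (simp add: same_shape_def)

lemma same_shape_sym: "same_shape S T \<Longrightarrow> same_shape T S"
  by (simp add: same_shape_def)

lemma same_shape_trans [trans]: "same_shape S T \<Longrightarrow> same_shape T U \<Longrightarrow> same_shape S U"
  by (simp add: same_shape_def)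

lemma colour_types_subset:
  assumes "T \<in> colour_types c n"
  shows "T i \<subseteq> {1..n}"
proof (cases "i \<le> c")
  case True
  then have "T i \<subseteq> (\<Union>i\<le>c. T i)" by (intro UN_upper) simp
  then show ?thesis using assms by (simp add: colour_types_def)
next
  case False
  then show ?thesis using assms by (simp add: colour_types_def)
qed

lemma colour_types_finite: "T \<in> colour_types c n \<Longrightarrow> finite (T i)"
  by (rule finite_subset[OF colour_types_subset]) auto

lemma colour_types_empty: "T \<in> colour_types c n \<Longrightarrow> c < i \<Longrightarrow> T i = {}"
  by (simp add: colour_types_def)

lemma colour_types_disjoint:
  "T \<in> colour_types c n \<Longrightarrow> x \<in> T i \<Longrightarrow> x \<in> T j \<Longrightarrow> i = j"
  unfolding colour_types_def by blast

lemma colour_types_cover: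
  assumes "T \<in> colour_types c n" "1 \<le> x" "x \<le> n"
  obtains i where "i \<le> c" "x \<in> T i"
proof -
  have "x \<in> (\<Union>i\<le>c. T i)" using assms by (simp add: colour_types_def)
  then show thesis using that by blast
qed

lemma colour_types_sum_card:
  assumes "T \<in> colour_types c n"
  shows "(\<Sum>i\<le>c. card (T i)) = n"
proof -
  have "card (\<Union>i\<le>c. T i) = (\<Sum>i\<le>c. card (T i))"
    using assms colour_types_finite[OF assms]
    by (intro card_UN_disjoint) (auto simp: colour_types_def)
  then show ?thesis using assms by (simp add: colour_types_def)
qed

text \<open>Comparing types thereby reduces to the true colours, which are the only labels visible
  in an edge set.\<close>

lemma colour_types_zero:
  assumes "T \<in> colour_types c n"
  shows "T 0 = {1..n} - (\<Union>i\<in>{1..c}. T i)"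
proof (intro equalityI subsetI)
  fix x assume "x \<in> T 0"
  then show "x \<in> {1..n} - (\<Union>i\<in>{1..c}. T i)"
    using colour_types_subset[OF assms, of 0] colour_types_disjoint[OF assms, of x 0] by force
next
  fix x assume x: "x \<in> {1..n} - (\<Union>i\<in>{1..c}. T i)"
  then obtain i where "i \<le> c" "x \<in> T i"
    using colour_types_cover[OF assms, of x] by auto
  with x show "x \<in> T 0" by (cases "i = 0") auto
qed

lemma colour_types_eqI:
  assumes "S \<in> colour_types c n" "T \<in> colour_types c n" "\<And>i. i \<noteq> 0 \<Longrightarrow> S i = T i"
  shows "S = T"
proof
  fix i
  show "S i = T i"
    using assms(3) colour_types_zero[OF assms(1)] colour_types_zero[OF assms(2)]
    by (cases "i = 0") auto
qed

text \<open>All cardinalities add up to \<open>n\<close>, so the number of isolated vertices is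
  forced by the other numbers.\<close>

lemma same_shapeI:
  assumes S: "S \<in> colour_types c n" and T: "T \<in> colour_types c n"
    and eq: "\<And>i. i \<noteq> 0 \<Longrightarrow> card (S i) = card (T i)"
  shows "same_shape S T"
proof -
  have "card (S 0) + (\<Sum>i\<in>{..c} - {0}. card (S i)) = n"
    using colour_types_sum_card[OF S] by (simp add: sum.remove[of _ 0])
  moreover have "card (T 0) + (\<Sum>i\<in>{..c} - {0}. card (T i)) = n"
    using colour_types_sum_card[OF T] by (simp add: sum.remove[of _ 0])
  moreover have "(\<Sum>i\<in>{..c} - {0}. card (S i)) = (\<Sum>i\<in>{..c} - {0}. card (T i))"
    using eq by (intro sum.cong) auto
  ultimately have "card (S 0) = card (T 0)" by linarith
  then show ?thesis
    unfolding same_shape_def using eq by metis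
qed

section \<open>Edges of a diagram: uniqueness, monotonicity, subdiagrams, reflection\<close>

lemma diagram_edge:
  assumes "d \<in> diagrams c n" "(i, j, a) \<in> d"
  shows "1 \<le> i" "i \<le> n" "1 \<le> j" "j \<le> n" "a \<noteq> 0" "a \<le> c"
  using assms unfolding diagrams_def by force+

lemma diagram_unique:
  assumes d: "d \<in> diagrams c n" and e: "(i, j, a) \<in> d" "(i', j', a') \<in> d" and "i = i' \<or> j = j'"
  shows "i = i' \<and> j = j' \<and> a = a'"
proof -
  have "\<forall>(i, j, a)\<in>d. \<forall>(i', j', a')\<in>d. i = i' \<or> j = j' \<longrightarrow> (i, j, a) = (i', j', a')"
    using d by (simp add: diagrams_def)
  from bspec[OF this e(1)] e(2) show ?thesis using assms(4) by fastforce
qed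

lemma diagram_top_unique:
  "d \<in> diagrams c n \<Longrightarrow> (i, j, a) \<in> d \<Longrightarrow> (i, j', a') \<in> d \<Longrightarrow> j = j' \<and> a = a'"
  using diagram_unique[of d c n i j a i j' a'] by simp

lemma diagram_bottom_unique:
  "d \<in> diagrams c n \<Longrightarrow> (i, j, a) \<in> d \<Longrightarrow> (i', j, a') \<in> d \<Longrightarrow> i = i' \<and> a = a'"
  using diagram_unique[of d c n i j a i' j a'] by simp

text \<open>The definition gives monotonicity from top to bottom only. For the converse, equal top
  ends would give equal bottom ends, and the opposite order above would give the opposite order
  below.\<close>

lemma diagram_less:
  assumes "d \<in> diagrams c n" "(i, j, a) \<in> d" "(i', j', a) \<in> d"
  shows "i < i' \<longleftrightarrow> j < j'"
proof -
  have *: "j < j'" if e: "(i, j, a) \<in> d" "(i', j', a) \<in> d" and "i < i'" for i j i' j'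
  proof -
    have "\<forall>(i, j, a)\<in>d. \<forall>(i', j', a')\<in>d. a = a' \<and> i < i' \<longrightarrow> j < j'"
      using assms(1) by (simp add: diagrams_def)
    from bspec[OF this e(1)] e(2) show ?thesis using \<open>i < i'\<close> by fastforce
  qed
  show ?thesis
  proof
    assume "j < j'"
    then have "i \<noteq> i'" using diagram_top_unique[OF assms(1,2), of j' a] assms(3) by auto
    moreover have "\<not> i' < i" using *[OF assms(3,2)] \<open>j < j'\<close> by auto
    ultimately show "i < i'" by simp
  qed (rule *[OF assms(2,3)])
qed

lemma diagramsI:
  assumes "\<And>i j a. (i, j, a) \<in> d \<Longrightarrow> 1 \<le> i \<and> i \<le> n \<and> 1 \<le> j \<and> j \<le> n \<and> 1 \<le> a \<and> a \<le> c"
    and "\<And>i j j' a a'. (i, j, a) \<in> d \<Longrightarrow> (i, j', a') \<in> d \<Longrightarrow> j = j' \<and> a = a'"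
    and "\<And>i i' j a a'. (i, j, a) \<in> d \<Longrightarrow> (i', j, a') \<in> d \<Longrightarrow> i = i' \<and> a = a'"
    and "\<And>i i' j j' a. (i, j, a) \<in> d \<Longrightarrow> (i', j', a) \<in> d \<Longrightarrow> i < i' \<Longrightarrow> j < j'"
  shows "d \<in> diagrams c n"
  unfolding diagrams_def
proof (intro CollectI conjI)
  show "d \<subseteq> {1..n} \<times> {1..n} \<times> {1..c}"
  proof
    fix e assume "e \<in> d"
    moreover obtain i j a where "e = (i, j, a)" by (metis prod_cases3)
    ultimately show "e \<in> {1..n} \<times> {1..n} \<times> {1..c}" using assms(1) by auto
  qed
  show "\<forall>(i, j, a)\<in>d. \<forall>(i', j', a')\<in>d. i = i' \<or> j = j' \<longrightarrow> (i, j, a) = (i', j', a')"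
    using assms(2,3) by blast
  show "\<forall>(i, j, a)\<in>d. \<forall>(i', j', a')\<in>d. a = a' \<and> i < i' \<longrightarrow> j < j'"
    using assms(4) by blast
qed

lemma finite_diagrams: "finite (diagrams c n)"
  by (rule finite_subset[of _ "Pow ({1..n} \<times> {1..n} \<times> {1..c})"]) (auto simp: diagrams_def)

lemma diagram_finite: "d \<in> diagrams c n \<Longrightarrow> finite d"
  by (rule finite_subset[of _ "{1..n} \<times> {1..n} \<times> {1..c}"]) (auto simp: diagrams_def)

lemma diagrams_subset:
  assumes d: "d \<in> diagrams c n" and "d' \<subseteq> d"
  shows "d' \<in> diagrams c n"
proof (rule diagramsI)
  have sub: "(i, j, a) \<in> d" if "(i, j, a) \<in> d'" for i j a
    using that \<open>d' \<subseteq> d\<close> by blast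
  show "1 \<le> i \<and> i \<le> n \<and> 1 \<le> j \<and> j \<le> n \<and> 1 \<le> a \<and> a \<le> c" if "(i, j, a) \<in> d'" for i j a
    using diagram_edge[OF d sub[OF that]] by simp
  show "j = j' \<and> a = a'" if "(i, j, a) \<in> d'" "(i, j', a') \<in> d'" for i j j' a a'
    using diagram_top_unique[OF d sub sub] that by blast
  show "i = i' \<and> a = a'" if "(i, j, a) \<in> d'" "(i', j, a') \<in> d'" for i i' j a a'
    using diagram_bottom_unique[OF d sub sub] that by blast
  show "j < j'" if "(i, j, a) \<in> d'" "(i', j', a) \<in> d'" "i < i'" for i i' j j' a
    using diagram_less[OF d sub sub] that by blast
qed

lemma flip_in_diagrams:
  assumes "d \<in> diagrams c n"
  shows "flip d \<in> diagrams c n"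
  using diagram_edge[OF assms] diagram_top_unique[OF assms] diagram_bottom_unique[OF assms]
    diagram_less[OF assms]
  by (intro diagramsI) (auto simp: Suc_le_eq)

section \<open>Correspondence between diagrams and pairs of types of equal shape\<close>

lemma bottom_type_in_colour_types:
  assumes "d \<in> diagrams c n"
  shows "bottom_type n d \<in> colour_types c n"
  unfolding colour_types_def
proof (intro CollectI conjI allI impI)
  show "bottom_type n d i = {}" if "c < i" for i
    using that diagram_edge(6)[OF assms] by (fastforce simp: bottom_type_def)
  show "(\<Union>i\<le>c. bottom_type n d i) = {1..n}"
  proof (intro equalityI subsetI)
    fix x assume "x \<in> (\<Union>i\<le>c. bottom_type n d i)"
    then show "x \<in> {1..n}"
      using diagram_edge(3,4)[OF assms] by (fastforce simp: bottom_type_def split: if_splits)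
  next
    fix x assume x: "x \<in> {1..n}"
    show "x \<in> (\<Union>i\<le>c. bottom_type n d i)"
    proof (cases "\<exists>t a. (t, x, a) \<in> d")
      case True
      then obtain t a where "(t, x, a) \<in> d" by blast
      then have "a \<le> c" "x \<in> bottom_type n d a"
        using diagram_edge(5,6)[OF assms] by (auto simp: bottom_type_def)
      then show ?thesis by blast
    next
      case False
      with x have "x \<in> bottom_type n d 0" by (simp add: bottom_type_def)
      then show ?thesis by blast
    qed
  qed
  show "bottom_type n d i \<inter> bottom_type n d j = {}" if "i \<noteq> j" for i j
    using that diagram_bottom_unique[OF assms] by (auto simp: bottom_type_def)
qed

lemma type_diagram_in_diagrams:
  assumes S: "S \<in> colour_types c n" and T: "T \<in> colour_types c n"
  shows "type_diagram S T \<in> diagrams c n"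
proof (rule diagramsI)
  show "1 \<le> i \<and> i \<le> n \<and> 1 \<le> j \<and> j \<le> n \<and> 1 \<le> a \<and> a \<le> c" if "(i, j, a) \<in> type_diagram S T" for i j a
  proof -
    have "i \<in> S a" "j \<in> T a" "a \<noteq> 0" using that by (auto simp: type_diagram_def)
    moreover from this have "a \<le> c" using colour_types_empty[OF S, of a] by force
    ultimately show ?thesis
      using colour_types_subset[OF S, of a] colour_types_subset[OF T, of a] by auto
  qed
  show "j = j' \<and> a = a'"
    if e: "(i, j, a) \<in> type_diagram S T" "(i, j', a') \<in> type_diagram S T" for i j j' a a'
  proof -
    have "a = a'" using e colour_types_disjoint[OF S] by (auto simp: type_diagram_def)
    then show ?thesis
      using e rank_eq_iff[OF colour_types_finite[OF T], of j a j'] by (auto simp: type_diagram_def)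
  qed
  show "i = i' \<and> a = a'"
    if e: "(i, j, a) \<in> type_diagram S T" "(i', j, a') \<in> type_diagram S T" for i i' j a a'
  proof -
    have "a = a'" using e colour_types_disjoint[OF T] by (auto simp: type_diagram_def)
    then show ?thesis
      using e rank_eq_iff[OF colour_types_finite[OF S], of i a i'] by (auto simp: type_diagram_def)
  qed
  show "j < j'"
    if e: "(i, j, a) \<in> type_diagram S T" "(i', j', a) \<in> type_diagram S T" "i < i'" for i i' j j' a
    using e rank_less_iff[OF colour_types_finite[OF S], of i a i']
      rank_less_iff[OF colour_types_finite[OF T], of j a j']
    by (auto simp: type_diagram_def)
qed

lemma flip_type_diagram: "flip (type_diagram S T) = type_diagram T S"
  by (auto simp: flip_def type_diagram_def)

text \<open>Equal shape ensures that no coloured vertex of \<open>T\<close> stays isolated: the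
  ranks in \<open>S a\<close> and in \<open>T a\<close> run through the same initial segment, so
  each vertex of \<open>T a\<close> finds a partner.\<close>

lemma bottom_type_type_diagram:
  assumes S: "S \<in> colour_types c n" and T: "T \<in> colour_types c n" and "same_shape S T"
  shows "bottom_type n (type_diagram S T) = T"
proof (rule colour_types_eqI[OF bottom_type_in_colour_types[OF type_diagram_in_diagrams[OF S T]] T])
  fix a :: nat assume "a \<noteq> 0"
  show "bottom_type n (type_diagram S T) a = T a"
  proof (intro equalityI subsetI)
    fix j assume j: "j \<in> T a"
    have "rank (T a) j \<in> rank (S a) ` S a"
      using j \<open>same_shape S T\<close> rank_image[OF colour_types_finite[OF T]]
        rank_image[OF colour_types_finite[OF S]]
      by (metis imageI same_shape_def)
    with j \<open>a \<noteq> 0\<close> show "j \<in> bottom_type n (type_diagram S T) a"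
      by (auto simp: bottom_type_def type_diagram_def)
  qed (use \<open>a \<noteq> 0\<close> in \<open>auto simp: bottom_type_def type_diagram_def\<close>)
qed

lemma top_type_type_diagram:
  assumes "S \<in> colour_types c n" "T \<in> colour_types c n" "same_shape S T"
  shows "top_type n (type_diagram S T) = S"
  using bottom_type_type_diagram[of T c n S] assms by (simp add: flip_type_diagram same_shape_sym)

text \<open>Edges of one colour keep their order, so they restrict to a bijection between the ends
  to the left of \<open>i\<close> and the ends to the left of \<open>j\<close>.\<close>

lemma diagram_rank:
  assumes d: "d \<in> diagrams c n" and e: "(i, j, a) \<in> d"
  shows "rank (top_type n d a) i = rank (bottom_type n d a) j"
proof -
  have a: "a \<noteq> 0" using diagram_edge[OF d e] by simp
  have "bij_betw (\<lambda>x. THE y. (x, y, a) \<in> d)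
      {x \<in> top_type n d a. x < i} {y \<in> bottom_type n d a. y < j}"
  proof (rule bij_betw_byWitness[where f' = "\<lambda>y. THE x. (x, y, a) \<in> d"])
    have the1: "(THE y. (x, y, a) \<in> d) = y" if "(x, y, a) \<in> d" for x y
      using that diagram_top_unique[OF d] by blast
    have the2: "(THE x. (x, y, a) \<in> d) = x" if "(x, y, a) \<in> d" for x y
      using that diagram_bottom_unique[OF d] by blast
    show "\<forall>x\<in>{x \<in> top_type n d a. x < i}. (THE z. (z, THE y. (x, y, a) \<in> d, a) \<in> d) = x"
      using a the1 the2 by (auto simp: bottom_type_def)
    show "\<forall>y\<in>{y \<in> bottom_type n d a. y < j}. (THE z. (THE x. (x, y, a) \<in> d, z, a) \<in> d) = y"
      using a the1 the2 by (auto simp: bottom_type_def)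
    show "(\<lambda>x. THE y. (x, y, a) \<in> d) ` {x \<in> top_type n d a. x < i}
        \<subseteq> {y \<in> bottom_type n d a. y < j}"
      using a the1 diagram_less[OF d _ e] by (fastforce simp: bottom_type_def)
    show "(\<lambda>y. THE x. (x, y, a) \<in> d) ` {y \<in> bottom_type n d a. y < j}
        \<subseteq> {x \<in> top_type n d a. x < i}"
      using a the2 diagram_less[OF d _ e] by (fastforce simp: bottom_type_def)
  qed
  then show ?thesis unfolding rank_def by (rule bij_betw_same_card)
qed

text \<open>By \<open>diagram_rank\<close> the edge leaving \<open>i\<close> in colour
  \<open>a\<close> ends at the vertex of the same rank, and within a finite set the rank determines
  the vertex. Hence the two types leave no freedom.\<close>

lemma type_diagram_of_diagram:
  assumes d: "d \<in> diagrams c n"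
  shows "type_diagram (top_type n d) (bottom_type n d) = d"
proof -
  have "(i, j, a) \<in> type_diagram (top_type n d) (bottom_type n d) \<longleftrightarrow> (i, j, a) \<in> d" for i j a
  proof
    assume e: "(i, j, a) \<in> d"
    then show "(i, j, a) \<in> type_diagram (top_type n d) (bottom_type n d)"
      using diagram_edge(5)[OF d e] diagram_rank[OF d e]
      by (auto simp: type_diagram_def bottom_type_def)
  next
    assume D: "(i, j, a) \<in> type_diagram (top_type n d) (bottom_type n d)"
    then have a: "a \<noteq> 0" and j: "j \<in> bottom_type n d a"
      and r: "rank (top_type n d a) i = rank (bottom_type n d a) j"
      by (auto simp: type_diagram_def)
    from D a obtain j' where e: "(i, j', a) \<in> d"
      by (auto simp: type_diagram_def bottom_type_def)
    then have j': "j' \<in> bottom_type n d a" using a by (auto simp: bottom_type_def)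
    have "rank (bottom_type n d a) j' = rank (bottom_type n d a) j"
      using r diagram_rank[OF d e] by simp
    then have "j' = j"
      using rank_eq_iff j j' colour_types_finite[OF bottom_type_in_colour_types[OF d]] by blast
    with e show "(i, j, a) \<in> d" by simp
  qed
  then show ?thesis by auto
qed

text \<open>For a true colour the edges themselves are the bijection; the isolated vertices then
  agree in number by \<open>same_shapeI\<close>.\<close>

lemma diagram_same_shape:
  assumes d: "d \<in> diagrams c n"
  shows "same_shape (top_type n d) (bottom_type n d)"
proof (rule same_shapeI[OF bottom_type_in_colour_types[OF flip_in_diagrams[OF d]]
      bottom_type_in_colour_types[OF d]])
  fix a :: nat assume a: "a \<noteq> 0"
  have the1: "(THE y. (x, y, a) \<in> d) = y" if "(x, y, a) \<in> d" for x y
    using that diagram_top_unique[OF d] by blast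
  have the2: "(THE x. (x, y, a) \<in> d) = x" if "(x, y, a) \<in> d" for x y
    using that diagram_bottom_unique[OF d] by blast
  have "bij_betw (\<lambda>x. THE y. (x, y, a) \<in> d) (top_type n d a) (bottom_type n d a)"
    by (rule bij_betw_byWitness[where f' = "\<lambda>y. THE x. (x, y, a) \<in> d"])
      (use a the1 the2 in \<open>auto simp: bottom_type_def\<close>)
  then show "card (top_type n d a) = card (bottom_type n d a)"
    by (rule bij_betw_same_card)
qed

lemma bottom_types_eq: "bottom_types c n = colour_types c n"
proof
  show "bottom_types c n \<subseteq> colour_types c n"
    using bottom_type_in_colour_types by (auto simp: bottom_types_def)
  show "colour_types c n \<subseteq> bottom_types c n"
  proof
    fix T assume T: "T \<in> colour_types c n"
    \<comment> \<open>With equal types above and below, all edges are vertical; this diagram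
      realises \<open>T\<close>.\<close>
    then have "bottom_type n (type_diagram T T) = T" "type_diagram T T \<in> diagrams c n"
      by (simp_all add: bottom_type_type_diagram type_diagram_in_diagrams)
    then show "T \<in> bottom_types c n" unfolding bottom_types_def by (metis imageI)
  qed
qed

section \<open>Multiplication of formal combinations\<close>

interpretation comb_pair: vector_space_pair cscale cscale
  by unfold_locales

lemma cscale_single [simp]: "cscale z (Poly_Mapping.single d w) = Poly_Mapping.single d (z * w)"
  by (rule poly_mapping_eqI) (simp add: lookup_single when_def)

lemma sum_single_lookup:
  fixes f :: comb
  shows "f = (\<Sum>d\<in>Poly_Mapping.keys f. Poly_Mapping.single d (Poly_Mapping.lookup f d))"
  by (rule poly_mapping_eqI)
    (auto simp: lookup_sum lookup_single when_def in_keys_iff sum.delta')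

text \<open>The product is a sum over exact supports, which change under addition and scaling. Over
  larger finite index sets the extra terms vanish and several factors can share one index set, so
  bilinearity becomes a termwise statement.\<close>

lemma comb_mult_supersets:
  assumes "finite A" "Poly_Mapping.keys f \<subseteq> A" "finite B" "Poly_Mapping.keys g \<subseteq> B"
  shows "comb_mult f g = (\<Sum>d1\<in>A. \<Sum>d2\<in>B.
    Poly_Mapping.single (stack d1 d2) (Poly_Mapping.lookup f d1 * Poly_Mapping.lookup g d2))"
proof -
  have "comb_mult f g = (\<Sum>d1\<in>Poly_Mapping.keys f. \<Sum>d2\<in>B.
      Poly_Mapping.single (stack d1 d2) (Poly_Mapping.lookup f d1 * Poly_Mapping.lookup g d2))"
    unfolding comb_mult_def using assms
    by (intro sum.cong refl sum.mono_neutral_left) (auto simp: in_keys_iff)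
  also have "\<dots> = (\<Sum>d1\<in>A. \<Sum>d2\<in>B.
      Poly_Mapping.single (stack d1 d2) (Poly_Mapping.lookup f d1 * Poly_Mapping.lookup g d2))"
    using assms by (intro sum.mono_neutral_left) (auto simp: in_keys_iff)
  finally show ?thesis .
qed

lemma comb_mult_add_left: "comb_mult (f + f') g = comb_mult f g + comb_mult f' g"
proof -
  let ?A = "Poly_Mapping.keys f \<union> Poly_Mapping.keys f'" and ?B = "Poly_Mapping.keys g"
  have "Poly_Mapping.keys (f + f') \<subseteq> ?A" by (rule keys_add)
  then show ?thesis
    using comb_mult_supersets[of ?A "f + f'" ?B g] comb_mult_supersets[of ?A f ?B g]
      comb_mult_supersets[of ?A f' ?B g]
    by (simp add: lookup_add distrib_right single_add sum.distrib)
qed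

lemma comb_mult_add_right: "comb_mult f (g + g') = comb_mult f g + comb_mult f g'"
proof -
  let ?A = "Poly_Mapping.keys g \<union> Poly_Mapping.keys g'" and ?B = "Poly_Mapping.keys f"
  have "Poly_Mapping.keys (g + g') \<subseteq> ?A" by (rule keys_add)
  then show ?thesis
    using comb_mult_supersets[of ?B f ?A "g + g'"] comb_mult_supersets[of ?B f ?A g]
      comb_mult_supersets[of ?B f ?A g']
    by (simp add: lookup_add distrib_left single_add sum.distrib)
qed

lemma keys_cscale: "Poly_Mapping.keys (cscale z f) \<subseteq> Poly_Mapping.keys f"
  by (auto simp: in_keys_iff)

lemma comb_mult_cscale_left: "comb_mult (cscale z f) g = cscale z (comb_mult f g)"
  using comb_mult_supersets[of "Poly_Mapping.keys f" "cscale z f" "Poly_Mapping.keys g" g]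
  by (simp add: keys_cscale comb_mult_def comb.scale_sum_right mult.assoc)

lemma comb_mult_cscale_right: "comb_mult f (cscale z g) = cscale z (comb_mult f g)"
  using comb_mult_supersets[of "Poly_Mapping.keys f" f "Poly_Mapping.keys g" "cscale z g"]
  by (simp add: keys_cscale comb_mult_def comb.scale_sum_right mult.left_commute)

lemma linear_comb_mult_left: "Vector_Spaces.linear cscale cscale (\<lambda>f. comb_mult f g)"
  by (intro Vector_Spaces.linear_iff[THEN iffD2] conjI allI)
    (simp_all add: comb.vector_space_axioms comb_mult_add_left comb_mult_cscale_left)

lemma linear_comb_mult_right: "Vector_Spaces.linear cscale cscale (comb_mult f)"
  by (intro Vector_Spaces.linear_iff[THEN iffD2] conjI allI)
    (simp_all add: comb.vector_space_axioms comb_mult_add_right comb_mult_cscale_right)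

lemma comb_mult_zero_left [simp]: "comb_mult 0 g = 0"
  by (simp add: comb_mult_def)

lemma comb_mult_zero_right [simp]: "comb_mult f 0 = 0"
  by (simp add: comb_mult_def)

lemma comb_mult_sum_left: "comb_mult (\<Sum>i\<in>I. f i) g = (\<Sum>i\<in>I. comb_mult (f i) g)"
  by (rule comb_pair.linear_sum[OF linear_comb_mult_left])

lemma comb_mult_sum_right: "comb_mult f (\<Sum>i\<in>I. g i) = (\<Sum>i\<in>I. comb_mult f (g i))"
  by (rule comb_pair.linear_sum[OF linear_comb_mult_right])

lemma comb_mult_single [simp]:
  "comb_mult (Poly_Mapping.single d z) (Poly_Mapping.single e w) =
     Poly_Mapping.single (stack d e) (z * w)"
  using comb_mult_supersets[of "{d}" "Poly_Mapping.single d z" "{e}" "Poly_Mapping.single e w"]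
  by simp

lemma stack_assoc: "stack (stack d e) f = stack d (stack e f)"
  unfolding stack_def by blast

text \<open>By bilinearity only single diagrams matter, and \<open>stack\<close> composes the edges
  of each colour as relations.\<close>

lemma comb_mult_assoc: "comb_mult (comb_mult f g) h = comb_mult f (comb_mult g h)"
proof -
  have "comb_mult (comb_mult (\<Sum>d\<in>A. Poly_Mapping.single d (p d))
          (\<Sum>d\<in>B. Poly_Mapping.single d (q d))) (\<Sum>d\<in>C. Poly_Mapping.single d (r d)) =
        comb_mult (\<Sum>d\<in>A. Poly_Mapping.single d (p d))
          (comb_mult (\<Sum>d\<in>B. Poly_Mapping.single d (q d)) (\<Sum>d\<in>C. Poly_Mapping.single d (r d)))"
    for A B C :: "diagram set" and p q r
    by (simp add: comb_mult_sum_left comb_mult_sum_right stack_assoc mult.assoc)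
  from this[of "Poly_Mapping.lookup f" "Poly_Mapping.keys f" "Poly_Mapping.lookup g"
      "Poly_Mapping.keys g" "Poly_Mapping.lookup h" "Poly_Mapping.keys h"]
  show ?thesis by (simp flip: sum_single_lookup)
qed


section \<open>Matrix units\<close>

lemma inj_on_insert_Pow: "e \<notin> d \<Longrightarrow> inj_on (insert e) (Pow d)"
  by (auto simp: inj_on_def)

text \<open>Subsets of \<open>insert e b\<close> come in pairs that differ by \<open>e\<close>: the
  values of \<open>F\<close> agree and the signs are opposite.\<close>

lemma sum_Pow_insert_cancel:
  assumes "finite b" "e \<notin> b" "\<And>b'. b' \<subseteq> b \<Longrightarrow> F (insert e b') = F b'"
  shows "(\<Sum>a\<in>Pow (insert e b).
    Poly_Mapping.single (F a) ((-1) ^ (card (insert e b) - card a) :: complex)) = 0"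
proof -
  let ?s = "\<lambda>a. Poly_Mapping.single (F a) ((-1) ^ (card (insert e b) - card a) :: complex)"
  have inj: "inj_on (insert e) (Pow b)"
    by (rule inj_on_insert_Pow[OF \<open>e \<notin> b\<close>])
  have "sum ?s (Pow (insert e b)) = sum ?s (Pow b) + sum ?s (insert e ` Pow b)"
    unfolding Pow_insert using assms(1,2) by (intro sum.union_disjoint) auto
  also have "sum ?s (insert e ` Pow b) = (\<Sum>a\<in>Pow b. ?s (insert e a))"
    using inj by (simp add: sum.reindex)
  also have "\<dots> = (\<Sum>a\<in>Pow b. - ?s a)"
  proof (rule sum.cong[OF refl])
    fix a assume "a \<in> Pow b"
    then have "finite a" "e \<notin> a" "card a \<le> card b" "F (insert e a) = F a"
      using assms finite_subset card_mono by auto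
    then show "?s (insert e a) = - ?s a"
      using assms(1,2) by (simp add: Suc_diff_le single_uminus)
  qed
  finally show ?thesis by (simp add: sum_negf)
qed

lemma single_mult_alternating:
  "comb_mult (Poly_Mapping.single d z) (alternating a) =
     cscale z (\<Sum>a'\<in>Pow a. Poly_Mapping.single (stack d a') ((-1) ^ (card a - card a')))"
  by (simp add: alternating_def comb_mult_sum_right comb.scale_sum_right)

lemma alternating_mult_single:
  "comb_mult (alternating d) (Poly_Mapping.single a z) =
     cscale z (\<Sum>d'\<in>Pow d. Poly_Mapping.single (stack d' a) ((-1) ^ (card d - card d')))"
  by (simp add: alternating_def comb_mult_sum_left comb.scale_sum_right mult.commute)

text \<open>The edge \<open>(j, k, l)\<close> of \<open>a\<close> continues no edge of
  \<open>d\<close>, so inserting it never changes the stack. An edge of \<open>d\<close> that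
  arrives at \<open>j\<close> in another colour does not prevent the cancellation.\<close>

lemma single_mult_alternating_eq_0:
  assumes "finite a" "(j, k, l) \<in> a" "\<And>i. (i, j, l) \<notin> d"
  shows "comb_mult (Poly_Mapping.single d z) (alternating a) = 0"
proof -
  obtain b where a: "a = insert (j, k, l) b" and b: "(j, k, l) \<notin> b"
    using assms(2) by (meson mk_disjoint_insert)
  have "stack d (insert (j, k, l) b') = stack d b'" for b'
    using assms(3) by (auto simp: stack_def)
  with assms(1) a b show ?thesis
    unfolding single_mult_alternating by (subst a)+ (subst sum_Pow_insert_cancel; simp)
qed

lemma alternating_mult_single_eq_0:
  assumes "finite d" "(i, j, l) \<in> d" "\<And>k. (j, k, l) \<notin> a"
  shows "comb_mult (alternating d) (Poly_Mapping.single a z) = 0"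
proof -
  obtain b where d: "d = insert (i, j, l) b" and b: "(i, j, l) \<notin> b"
    using assms(2) by (meson mk_disjoint_insert)
  have "stack (insert (i, j, l) b') a = stack b' a" for b'
    using assms(3) by (auto simp: stack_def)
  with assms(1) d b show ?thesis
    unfolding alternating_mult_single by (subst d)+ (subst sum_Pow_insert_cancel; simp)
qed

lemma alternating_mult_eq_0_right:
  assumes "finite a" "(j, k, l) \<in> a" "\<And>i. (i, j, l) \<notin> d"
  shows "comb_mult (alternating d) (alternating a) = 0"
proof -
  have "comb_mult (Poly_Mapping.single d' z) (alternating a) = 0" if "d' \<in> Pow d" for d' z
    using that assms by (intro single_mult_alternating_eq_0[of a j k l]) auto
  then show ?thesis
    by (subst alternating_def) (simp add: comb_mult_sum_left)
qed

lemma alternating_mult_eq_0_left: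
  assumes "finite d" "(i, j, l) \<in> d" "\<And>k. (j, k, l) \<notin> a"
  shows "comb_mult (alternating d) (alternating a) = 0"
proof -
  have "comb_mult (alternating d) (Poly_Mapping.single a' z) = 0" if "a' \<in> Pow a" for a' z
    using that assms by (intro alternating_mult_single_eq_0[of d i j l]) auto
  then show ?thesis
    by (subst (2) alternating_def) (simp add: comb_mult_sum_right)
qed

text \<open>Stacking below \<open>d\<close> merely moves the top ends of the edges of
  \<open>a\<close>, and does so injectively. Hence subsets of \<open>a\<close> correspond to subsets
  of the stack, with the same signs.\<close>

lemma single_mult_alternating_matched:
  assumes d: "d \<in> diagrams c n" and a: "a \<in> diagrams c n"
    and m: "\<And>j k l. (j, k, l) \<in> a \<Longrightarrow> \<exists>i. (i, j, l) \<in> d"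
  shows "comb_mult (Poly_Mapping.single d 1) (alternating a) = alternating (stack d a)"
proof -
  define p where "p = (\<lambda>(j, k :: nat, l). (THE i. (i, j, l) \<in> d, k, l))"
  have the: "(THE i. (i, j, l) \<in> d) = i" if "(i, j, l) \<in> d" for i j l
    using that diagram_bottom_unique[OF d] by blast
  have st: "stack d a' = p ` a'" if "a' \<subseteq> a" for a'
  proof (intro equalityI subsetI)
    fix e assume "e \<in> stack d a'"
    then obtain i j k l where "e = (i, k, l)" "(i, j, l) \<in> d" "(j, k, l) \<in> a'"
      by (auto simp: stack_def)
    then show "e \<in> p ` a'" using the by (force simp: p_def)
  next
    fix e assume "e \<in> p ` a'"
    then obtain j k l where e: "e = p (j, k, l)" "(j, k, l) \<in> a'" by auto
    then obtain i where "(i, j, l) \<in> d" using m \<open>a' \<subseteq> a\<close> by blast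
    with e the show "e \<in> stack d a'" by (auto simp: stack_def p_def)
  qed
  \<comment> \<open>\<open>p\<close> keeps the bottom end, which determines an edge of
    \<open>a\<close>.\<close>
  have inj: "inj_on p a"
  proof (rule inj_onI)
    fix e e' assume *: "e \<in> a" "e' \<in> a" "p e = p e'"
    obtain j k l where e: "e = (j, k, l)" by (metis prod_cases3)
    obtain j' k' l' where e': "e' = (j', k', l')" by (metis prod_cases3)
    show "e = e'"
      using * diagram_bottom_unique[OF a, of j k l j' l'] unfolding e e' p_def by auto
  qed
  have "alternating (stack d a) =
      (\<Sum>b\<in>(`) p ` Pow a. Poly_Mapping.single b ((-1) ^ (card (p ` a) - card b)))"
    by (simp add: alternating_def st image_Pow_surj)
  also have "\<dots> = (\<Sum>a'\<in>Pow a. Poly_Mapping.single (p ` a') ((-1) ^ (card (p ` a) - card (p ` a'))))"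
    using inj by (subst sum.reindex) (auto intro: inj_on_image_Pow)
  also have "\<dots> = (\<Sum>a'\<in>Pow a. Poly_Mapping.single (stack d a') ((-1) ^ (card a - card a')))"
    by (intro sum.cong refl) (use inj in \<open>auto simp: st card_image inj_on_subset\<close>)
  finally show ?thesis by (simp add: single_mult_alternating)
qed

text \<open>Only the left factor is expanded. A proper subset of \<open>d\<close> lacks some edge,
  whose continuation in \<open>a\<close> is then unmatched, so this subset kills
  \<open>alternating a\<close>. The term \<open>d\<close> itself survives, with sign 1.\<close>

lemma alternating_mult_matched:
  assumes d: "d \<in> diagrams c n" and a: "a \<in> diagrams c n"
    and m: "\<And>j k l. (j, k, l) \<in> a \<Longrightarrow> \<exists>i. (i, j, l) \<in> d"
    and m': "\<And>i j l. (i, j, l) \<in> d \<Longrightarrow> \<exists>k. (j, k, l) \<in> a"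
  shows "comb_mult (alternating d) (alternating a) = alternating (stack d a)"
proof -
  let ?t = "\<lambda>d'. comb_mult (Poly_Mapping.single d' ((-1) ^ (card d - card d'))) (alternating a)"
  have "?t d' = 0" if "d' \<in> Pow d - {d}" for d'
  proof -
    from that obtain i j l where e: "(i, j, l) \<in> d" "(i, j, l) \<notin> d'" by auto
    from m'[OF e(1)] obtain k where k: "(j, k, l) \<in> a" by blast
    have "(i', j, l) \<notin> d'" for i'
      using e that diagram_bottom_unique[OF d e(1), of i' l] by auto
    with diagram_finite[OF a] k show ?thesis by (intro single_mult_alternating_eq_0) auto
  qed
  then have "(\<Sum>d'\<in>Pow d. ?t d') = ?t d"
    using diagram_finite[OF d] by (subst sum.remove[of _ d]) auto
  then show ?thesis
    using single_mult_alternating_matched[OF d a m]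
    by (subst alternating_def) (simp add: comb_mult_sum_left)
qed

text \<open>Intended for types of equal shape: otherwise \<open>type_diagram\<close> leaves surplus
  vertices isolated and its types are no longer the pair \<open>S\<close>, \<open>T\<close>.\<close>

definition matrix_unit :: "(nat \<Rightarrow> nat set) \<Rightarrow> (nat \<Rightarrow> nat set) \<Rightarrow> comb" where
  "matrix_unit S T = alternating (type_diagram S T)"

lemma stack_type_diagram:
  assumes "T \<in> colour_types c n" "U \<in> colour_types c n" "same_shape T U"
  shows "stack (type_diagram S T) (type_diagram T U) = type_diagram S U"
proof -
  have "\<exists>j\<in>T a. rank (T a) j = rank (U a) k" if "k \<in> U a" for a k
    using that assms rank_image[OF colour_types_finite, of T c n a]
      rank_image[OF colour_types_finite, of U c n a]
    by (metis imageE imageI same_shape_def)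
  then show ?thesis by (force simp: stack_def type_diagram_def)
qed

text \<open>If \<open>T\<close> and \<open>S'\<close> differ, they differ in a true colour
  \<open>l\<close>, so some vertex of the middle row carries an edge of colour \<open>l\<close> on
  one side only. The side decides which of the two vanishing lemmas applies.\<close>

lemma matrix_unit_mult:
  assumes S: "S \<in> colour_types c n" and T: "T \<in> colour_types c n" and ST: "same_shape S T"
    and S': "S' \<in> colour_types c n" and T': "T' \<in> colour_types c n" and ST': "same_shape S' T'"
  shows "comb_mult (matrix_unit S T) (matrix_unit S' T') = (if T = S' then matrix_unit S T' else 0)"
proof -
  let ?d = "type_diagram S T" and ?a = "type_diagram S' T'"
  have d: "?d \<in> diagrams c n" and a: "?a \<in> diagrams c n"
    using assms by (auto intro: type_diagram_in_diagrams)
  have bot: "(\<exists>i. (i, j, l) \<in> ?d) \<longleftrightarrow> l \<noteq> 0 \<and> j \<in> T l" for j l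
    using fun_cong[OF bottom_type_type_diagram[OF S T ST], of l]
    by (cases "l = 0") (auto simp: bottom_type_def type_diagram_def)
  have top: "(\<exists>k. (j, k, l) \<in> ?a) \<longleftrightarrow> l \<noteq> 0 \<and> j \<in> S' l" for j l
    using fun_cong[OF top_type_type_diagram[OF S' T' ST'], of l]
    by (cases "l = 0") (auto simp: bottom_type_def type_diagram_def)
  show ?thesis
  proof (cases "T = S'")
    case True
    have "comb_mult (alternating ?d) (alternating ?a) = alternating (stack ?d ?a)"
    proof (rule alternating_mult_matched[OF d a])
      show "\<exists>i. (i, j, l) \<in> ?d" if "(j, k, l) \<in> ?a" for j k l
        using that bot[of j l] top[of j l] True by auto
      show "\<exists>k. (j, k, l) \<in> ?a" if "(i, j, l) \<in> ?d" for i j l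
        using that bot[of j l] top[of j l] True by auto
    qed
    then show ?thesis
      using True stack_type_diagram[OF S' T' ST'] by (simp add: matrix_unit_def)
  next
    case False
    then obtain l where l: "l \<noteq> 0" "T l \<noteq> S' l" using colour_types_eqI[OF T S'] by blast
    then consider j where "j \<in> T l" "j \<notin> S' l" | j where "j \<in> S' l" "j \<notin> T l" by blast
    then show ?thesis
    proof cases
      case 1
      obtain i where "(i, j, l) \<in> ?d" "\<And>k. (j, k, l) \<notin> ?a"
        using 1 l bot[of j l] top[of j l] by auto
      then show ?thesis
        using False alternating_mult_eq_0_left[OF diagram_finite[OF d]] by (simp add: matrix_unit_def)
    next
      case 2
      obtain k where "(j, k, l) \<in> ?a" "\<And>i. (i, j, l) \<notin> ?d"
        using 2 l bot[of j l] top[of j l] by auto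
      then show ?thesis
        using False alternating_mult_eq_0_right[OF diagram_finite[OF a]] by (simp add: matrix_unit_def)
    qed
  qed
qed

lemma lookup_alternating_self:
  assumes "finite d"
  shows "Poly_Mapping.lookup (alternating d) d = 1"
proof -
  have "Poly_Mapping.lookup (alternating d) d = (\<Sum>d'\<in>Pow d. if d' = d then 1 else 0)"
    unfolding alternating_def lookup_sum by (intro sum.cong) (auto simp: lookup_single when_def)
  then show ?thesis using assms by simp
qed

lemma lookup_matrix_unit:
  assumes "S \<in> colour_types c n" "T \<in> colour_types c n"
  shows "Poly_Mapping.lookup (matrix_unit S T) (type_diagram S T) = 1"
  unfolding matrix_unit_def
  by (rule lookup_alternating_self[OF diagram_finite[OF type_diagram_in_diagrams[OF assms]]])

lemma matrix_unit_nonzero: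
  assumes "S \<in> colour_types c n" "T \<in> colour_types c n"
  shows "matrix_unit S T \<noteq> 0"
  using lookup_matrix_unit[OF assms] by auto

section \<open>Matrix units span the algebra and, column by column, the modules\<close>

lemma alternating_eq_matrix_unit:
  "d \<in> diagrams c n \<Longrightarrow> alternating d = matrix_unit (top_type n d) (bottom_type n d)"
  by (simp add: matrix_unit_def type_diagram_of_diagram)

text \<open>\<open>alternating d\<close> is \<open>d\<close> plus a combination of proper subsets of
  \<open>d\<close>, so this inverts a unitriangular system by induction along inclusion.\<close>

lemma single_in_span_alternating:
  assumes "finite d"
  shows "Poly_Mapping.single d z \<in> comb.span (alternating ` Pow d)"
  using assms
proof (induction d arbitrary: z rule: finite_psubset_induct)
  case (psubset d)
  have "alternating d = (\<Sum>d'\<in>Pow d - {d}. Poly_Mapping.single d' ((-1) ^ (card d - card d')))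
      + Poly_Mapping.single d 1"
    unfolding alternating_def using \<open>finite d\<close> by (subst sum.remove[of _ d]) (auto simp: add.commute)
  then have "Poly_Mapping.single d 1 =
      alternating d - (\<Sum>d'\<in>Pow d - {d}. Poly_Mapping.single d' ((-1) ^ (card d - card d')))"
    by simp
  moreover have "Poly_Mapping.single d' w \<in> comb.span (alternating ` Pow d)" if "d' \<in> Pow d - {d}" for d' w
  proof -
    have "d' \<subset> d" using that by auto
    then have "alternating ` Pow d' \<subseteq> alternating ` Pow d" by auto
    with psubset.IH[OF \<open>d' \<subset> d\<close>, of w] show ?thesis
      using comb.span_mono by blast
  qed
  moreover have "alternating d \<in> comb.span (alternating ` Pow d)"
    by (intro comb.span_base) auto
  ultimately have "Poly_Mapping.single d 1 \<in> comb.span (alternating ` Pow d)"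
    by (auto intro!: comb.span_diff comb.span_sum)
  then have "cscale z (Poly_Mapping.single d 1) \<in> comb.span (alternating ` Pow d)"
    by (rule comb.span_scale)
  then show ?case by simp
qed

lemma keys_alternating: "Poly_Mapping.keys (alternating d) \<subseteq> Pow d"
proof
  fix x assume "x \<in> Poly_Mapping.keys (alternating d)"
  then have "(\<Sum>d'\<in>Pow d. Poly_Mapping.lookup
      (Poly_Mapping.single d' ((-1) ^ (card d - card d') :: complex)) x) \<noteq> 0"
    by (simp add: alternating_def in_keys_iff lookup_sum)
  then obtain d' where "d' \<in> Pow d"
    "Poly_Mapping.lookup (Poly_Mapping.single d' ((-1) ^ (card d - card d') :: complex)) x \<noteq> 0"
    by (rule sum.not_neutral_contains_not_neutral)
  then show "x \<in> Pow d" by (auto simp: lookup_single when_def split: if_splits)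
qed

lemma subspace_diagram_carrier: "comb.subspace (diagram_carrier c n)"
proof (rule comb.subspaceI)
  fix f g assume "f \<in> diagram_carrier c n" "g \<in> diagram_carrier c n"
  then show "f + g \<in> diagram_carrier c n"
    using keys_add[of f g] by (auto simp: diagram_carrier_def)
next
  fix z f assume "f \<in> diagram_carrier c n"
  then show "cscale z f \<in> diagram_carrier c n"
    using keys_cscale[of z f] by (auto simp: diagram_carrier_def)
qed (simp add: diagram_carrier_def)

text \<open>The alternating sum and its inversion involve only subsets of a diagram, which are
  diagrams again; both inclusions rest on this.\<close>

lemma diagram_carrier_eq_span: "diagram_carrier c n = comb.span (alternating ` diagrams c n)"
proof
  show "diagram_carrier c n \<subseteq> comb.span (alternating ` diagrams c n)"
  proof
    fix f assume f: "f \<in> diagram_carrier c n"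
    have "Poly_Mapping.single d z \<in> comb.span (alternating ` diagrams c n)"
      if "d \<in> Poly_Mapping.keys f" for d z
    proof -
      have d: "d \<in> diagrams c n" using f that by (auto simp: diagram_carrier_def)
      then have "alternating ` Pow d \<subseteq> alternating ` diagrams c n" using diagrams_subset by blast
      then show ?thesis
        using comb.span_mono single_in_span_alternating[OF diagram_finite[OF d]] by blast
    qed
    then have "(\<Sum>d\<in>Poly_Mapping.keys f. Poly_Mapping.single d (Poly_Mapping.lookup f d))
        \<in> comb.span (alternating ` diagrams c n)"
      by (intro comb.span_sum) auto
    then show "f \<in> comb.span (alternating ` diagrams c n)" by (simp flip: sum_single_lookup)
  qed
  show "comb.span (alternating ` diagrams c n) \<subseteq> diagram_carrier c n"
  proof (rule comb.span_minimal[OF _ subspace_diagram_carrier])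
    show "alternating ` diagrams c n \<subseteq> diagram_carrier c n"
      using keys_alternating diagrams_subset unfolding diagram_carrier_def by blast
  qed
qed

lemma alternating_diagrams_eq:
  "alternating ` diagrams c n =
     {matrix_unit S T | S T. S \<in> colour_types c n \<and> T \<in> colour_types c n \<and> same_shape S T}"
proof (intro equalityI subsetI)
  fix f assume "f \<in> alternating ` diagrams c n"
  then obtain d where "d \<in> diagrams c n" "f = alternating d" by blast
  then show "f \<in> {matrix_unit S T | S T. S \<in> colour_types c n \<and> T \<in> colour_types c n \<and> same_shape S T}"
    using alternating_eq_matrix_unit bottom_type_in_colour_types flip_in_diagrams diagram_same_shape
    by blast
next
  fix f assume "f \<in> {matrix_unit S T | S T. S \<in> colour_types c n \<and> T \<in> colour_types c n \<and> same_shape S T}"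
  then show "f \<in> alternating ` diagrams c n"
    using type_diagram_in_diagrams by (auto simp: matrix_unit_def)
qed

text \<open>Fixing the bottom type fixes the second index, so the spanning set of the module is one
  column of a matrix block.\<close>

lemma bottom_alternating_eq:
  assumes T: "T \<in> colour_types c n"
  shows "{alternating a | a. a \<in> diagrams c n \<and> bottom_type n a = T} =
     {matrix_unit S T | S. S \<in> colour_types c n \<and> same_shape S T}"
proof (intro equalityI subsetI)
  fix f assume "f \<in> {alternating a | a. a \<in> diagrams c n \<and> bottom_type n a = T}"
  then obtain d where d: "d \<in> diagrams c n" "f = alternating d" "bottom_type n d = T" by blast
  then show "f \<in> {matrix_unit S T | S. S \<in> colour_types c n \<and> same_shape S T}"
    using alternating_eq_matrix_unit[OF d(1)] bottom_type_in_colour_types[OF flip_in_diagrams[OF d(1)]]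
      diagram_same_shape[OF d(1)] by auto
next
  fix f assume "f \<in> {matrix_unit S T | S. S \<in> colour_types c n \<and> same_shape S T}"
  then show "f \<in> {alternating a | a. a \<in> diagrams c n \<and> bottom_type n a = T}"
    using type_diagram_in_diagrams[OF _ T] bottom_type_type_diagram[OF _ T]
    by (auto simp: matrix_unit_def)
qed

section \<open>The diagram algebra and its modules\<close>

lemma comb_mult_in_span:
  assumes "f \<in> comb.span A" "g \<in> comb.span B"
    and "\<And>a b. a \<in> A \<Longrightarrow> b \<in> B \<Longrightarrow> comb_mult a b \<in> comb.span C"
  shows "comb_mult f g \<in> comb.span C"
proof -
  have 1: "comb_mult a g \<in> comb.span C" if "a \<in> A" for a
    using assms(2)
  proof (induction rule: comb.span_induct)
    show "comb.subspace {g. comb_mult a g \<in> comb.span C}"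
      by (auto intro!: comb.subspaceI
          simp: comb.span_zero comb.span_add comb.span_scale comb_mult_add_right comb_mult_cscale_right)
  qed (use assms(3) that in simp)
  show ?thesis
    using assms(1)
  proof (induction rule: comb.span_induct)
    show "comb.subspace {f. comb_mult f g \<in> comb.span C}"
      by (auto intro!: comb.subspaceI
          simp: comb.span_zero comb.span_add comb.span_scale comb_mult_add_left comb_mult_cscale_left)
  qed (use 1 in simp)
qed

text \<open>Serves the multiplicativity of the embedding and the equivariance of the branching maps,
  which then need checking on matrix units only.\<close>

lemma bilinear_eq_on:
  assumes f: "f \<in> comb.span A" and g: "g \<in> comb.span B"
    and "\<And>y. Vector_Spaces.linear cscale cscale (\<lambda>x. P x y)"
    and "\<And>x. Vector_Spaces.linear cscale cscale (P x)"
    and "\<And>y. Vector_Spaces.linear cscale cscale (\<lambda>x. Q x y)"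
    and "\<And>x. Vector_Spaces.linear cscale cscale (Q x)"
    and eq: "\<And>a b. a \<in> A \<Longrightarrow> b \<in> B \<Longrightarrow> P a b = Q a b"
  shows "P f g = Q f g"
proof -
  have "P a g = Q a g" if "a \<in> A" for a
    using comb_pair.linear_eq_on[OF assms(4) assms(6) g, of a a] eq that by blast
  then show ?thesis
    using comb_pair.linear_eq_on[OF assms(3) assms(5) f, of g g] by blast
qed

abbreviation matrix_units :: "nat \<Rightarrow> nat \<Rightarrow> comb set" where
  "matrix_units c n \<equiv>
     {matrix_unit S T | S T. S \<in> colour_types c n \<and> T \<in> colour_types c n \<and> same_shape S T}"

lemma diagram_carrier_span: "diagram_carrier c n = comb.span (matrix_units c n)"
  by (simp add: diagram_carrier_eq_span alternating_diagrams_eq)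

lemma finite_colour_types: "finite (colour_types c n)"
  unfolding bottom_types_eq[symmetric] bottom_types_def using finite_diagrams by simp

text \<open>The identity matrix of all blocks at once.\<close>

definition algebra_unit :: "nat \<Rightarrow> nat \<Rightarrow> comb" where
  "algebra_unit c n = (\<Sum>T\<in>colour_types c n. matrix_unit T T)"

lemma matrix_unit_in_carrier:
  "S \<in> colour_types c n \<Longrightarrow> T \<in> colour_types c n \<Longrightarrow> same_shape S T \<Longrightarrow>
    matrix_unit S T \<in> diagram_carrier c n"
  unfolding diagram_carrier_span by (intro comb.span_base) blast

lemma algebra_unit_in_carrier: "algebra_unit c n \<in> diagram_carrier c n"
  unfolding algebra_unit_def
  by (intro comb.subspace_sum subspace_diagram_carrier matrix_unit_in_carrier) auto

lemma algebra_unit_left_matrix_unit: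
  assumes "S \<in> colour_types c n" "U \<in> colour_types c n" "same_shape S U"
  shows "comb_mult (algebra_unit c n) (matrix_unit S U) = matrix_unit S U"
proof -
  have "comb_mult (algebra_unit c n) (matrix_unit S U) =
      (\<Sum>T\<in>colour_types c n. if T = S then matrix_unit S U else 0)"
    unfolding algebra_unit_def comb_mult_sum_left using assms
    by (intro sum.cong) (auto simp: matrix_unit_mult[of _ c n])
  then show ?thesis using assms by (simp add: finite_colour_types)
qed

lemma algebra_unit_right_matrix_unit:
  assumes "S \<in> colour_types c n" "U \<in> colour_types c n" "same_shape S U"
  shows "comb_mult (matrix_unit S U) (algebra_unit c n) = matrix_unit S U"
proof -
  have "comb_mult (matrix_unit S U) (algebra_unit c n) =
      (\<Sum>T\<in>colour_types c n. if U = T then matrix_unit S U else 0)"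
    unfolding algebra_unit_def comb_mult_sum_right using assms
    by (intro sum.cong) (auto simp: matrix_unit_mult[of _ c n])
  then show ?thesis using assms by (simp add: finite_colour_types)
qed

lemma linear_ident: "Vector_Spaces.linear cscale cscale (\<lambda>x. x)"
  using comb.linear_id by (simp add: id_def)

lemma algebra_unit_left:
  assumes "f \<in> diagram_carrier c n"
  shows "comb_mult (algebra_unit c n) f = f"
  using comb_pair.linear_eq_on[OF linear_comb_mult_right linear_ident
      assms[unfolded diagram_carrier_span]] algebra_unit_left_matrix_unit by blast

lemma algebra_unit_right:
  assumes "f \<in> diagram_carrier c n"
  shows "comb_mult f (algebra_unit c n) = f"
  using comb_pair.linear_eq_on[OF linear_comb_mult_left linear_ident
      assms[unfolded diagram_carrier_span]] algebra_unit_right_matrix_unit by blast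

lemma comb_mult_in_carrier:
  assumes "f \<in> diagram_carrier c n" "g \<in> diagram_carrier c n"
  shows "comb_mult f g \<in> diagram_carrier c n"
proof -
  have "comb_mult a b \<in> comb.span (matrix_units c n)"
    if "a \<in> matrix_units c n" "b \<in> matrix_units c n" for a b
  proof -
    from that obtain S T S' T' where *: "a = matrix_unit S T" "b = matrix_unit S' T'"
      "S \<in> colour_types c n" "T \<in> colour_types c n" "same_shape S T"
      "S' \<in> colour_types c n" "T' \<in> colour_types c n" "same_shape S' T'" by blast
    show ?thesis
    proof (cases "T = S'")
      case True
      with * have "comb_mult a b = matrix_unit S T'" "same_shape S T'"
        by (auto simp: matrix_unit_mult[of _ c n] intro: same_shape_trans)
      then show ?thesis using * by (auto intro!: comb.span_base)
    next
      case False
      with * show ?thesis by (simp add: matrix_unit_mult[of _ c n] comb.span_zero)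
    qed
  qed
  then show ?thesis
    using assms comb_mult_in_span unfolding diagram_carrier_span by blast
qed

text \<open>Applies to the algebra and to its modules alike, since a module record extends a ring
  record.\<close>

lemma abelian_group_subspace:
  fixes M :: "(comb, 'm) ring_scheme"
  assumes "comb.subspace (carrier M)" "add M = (+)" "zero M = 0"
  shows "abelian_group M"
proof (rule abelian_groupI)
  fix x assume x: "x \<in> carrier M"
  then have "- x \<in> carrier M" by (rule comb.subspace_neg[OF assms(1)])
  with assms show "\<exists>y\<in>carrier M. y \<oplus>\<^bsub>M\<^esub> x = \<zero>\<^bsub>M\<^esub>"
    by (intro bexI[of _ "- x"]) auto
qed (use assms in \<open>auto simp: comb.subspace_add comb.subspace_0 add.assoc add.commute\<close>)

lemma diagram_algebra_simps [simp]:
  "carrier (diagram_algebra c n) = diagram_carrier c n"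
  "monoid.mult (diagram_algebra c n) = comb_mult"
  "zero (diagram_algebra c n) = 0"
  "add (diagram_algebra c n) = (+)"
  by (simp_all add: diagram_algebra_def)

text \<open>Two two-sided units coincide, so the definite description in
  \<open>diagram_algebra\<close> has this value.\<close>

lemma one_diagram_algebra [simp]: "one (diagram_algebra c n) = algebra_unit c n"
proof -
  have "(THE e. e \<in> diagram_carrier c n \<and>
      (\<forall>f \<in> diagram_carrier c n. comb_mult e f = f \<and> comb_mult f e = f)) = algebra_unit c n"
  proof (rule the_equality)
    show "algebra_unit c n \<in> diagram_carrier c n \<and> (\<forall>f \<in> diagram_carrier c n.
        comb_mult (algebra_unit c n) f = f \<and> comb_mult f (algebra_unit c n) = f)"
      by (simp add: algebra_unit_in_carrier algebra_unit_left algebra_unit_right)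
  next
    fix e assume e: "e \<in> diagram_carrier c n \<and>
      (\<forall>f \<in> diagram_carrier c n. comb_mult e f = f \<and> comb_mult f e = f)"
    then have "comb_mult e (algebra_unit c n) = algebra_unit c n"
      using algebra_unit_in_carrier by blast
    with e algebra_unit_right show "e = algebra_unit c n" by metis
  qed
  then show ?thesis by (simp add: diagram_algebra_def)
qed

lemma ring_diagram_algebra: "ring (diagram_algebra c n)"
proof (rule ringI)
  show "abelian_group (diagram_algebra c n)"
    by (rule abelian_group_subspace) (simp_all add: subspace_diagram_carrier)
  show "Group.monoid (diagram_algebra c n)"
    by (rule monoidI) (simp_all add: comb_mult_in_carrier algebra_unit_in_carrier comb_mult_assoc
        algebra_unit_left algebra_unit_right)
qed (simp_all add: comb_mult_add_left comb_mult_add_right)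

section \<open>Columns as irreducible modules\<close>

definition types_like :: "nat \<Rightarrow> nat \<Rightarrow> (nat \<Rightarrow> nat set) \<Rightarrow> (nat \<Rightarrow> nat set) set" where
  "types_like c n T = {S \<in> colour_types c n. same_shape S T}"

abbreviation type_space :: "nat \<Rightarrow> nat \<Rightarrow> (nat \<Rightarrow> nat set) \<Rightarrow> comb set" where
  "type_space c n T \<equiv> comb.span ((\<lambda>S. matrix_unit S T) ` types_like c n T)"

lemma finite_types_like: "finite (types_like c n T)"
  using finite_colour_types by (simp add: types_like_def)

lemma module_of_type_simps [simp]:
  "zero (module_of_type c n T) = 0"
  "add (module_of_type c n T) = (+)"
  "smult (module_of_type c n T) = comb_mult"
  by (simp_all add: module_of_type_def)

lemma carrier_module_of_type:
  assumes "T \<in> colour_types c n"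
  shows "carrier (module_of_type c n T) = type_space c n T"
proof -
  have "{matrix_unit S T | S. S \<in> colour_types c n \<and> same_shape S T} =
      (\<lambda>S. matrix_unit S T) ` types_like c n T"
    by (auto simp: types_like_def)
  then show ?thesis by (simp add: module_of_type_def bottom_alternating_eq[OF assms])
qed

lemma type_space_subset:
  assumes "T \<in> colour_types c n"
  shows "type_space c n T \<subseteq> diagram_carrier c n"
  unfolding diagram_carrier_span using assms
  by (intro comb.span_mono) (auto simp: types_like_def)

lemma type_space_closed:
  assumes f: "f \<in> diagram_carrier c n" and g: "g \<in> type_space c n T" and T: "T \<in> colour_types c n"
  shows "comb_mult f g \<in> type_space c n T"
proof -
  have "comb_mult a b \<in> type_space c n T"
    if "a \<in> matrix_units c n" "b \<in> (\<lambda>S. matrix_unit S T) ` types_like c n T" for a b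
  proof -
    from that obtain U V S where *: "a = matrix_unit U V" "b = matrix_unit S T"
      "U \<in> colour_types c n" "V \<in> colour_types c n" "same_shape U V"
      "S \<in> colour_types c n" "same_shape S T" by (auto simp: types_like_def)
    show ?thesis
    proof (cases "V = S")
      case True
      with * T have "comb_mult a b = matrix_unit U T" "same_shape U T"
        by (auto simp: matrix_unit_mult[of _ c n] intro: same_shape_trans)
      then show ?thesis using * by (auto intro!: comb.span_base simp: types_like_def)
    next
      case False
      with * T show ?thesis by (simp add: matrix_unit_mult[of _ c n] comb.span_zero)
    qed
  qed
  then show ?thesis using f g comb_mult_in_span unfolding diagram_carrier_span by blast
qed

lemma left_module_of_type:
  assumes T: "T \<in> colour_types c n"
  shows "left_module (diagram_algebra c n) (module_of_type c n T)"
proof (intro left_module.intro left_module_axioms.intro ring_diagram_algebra)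
  show "abelian_group (module_of_type c n T)"
    by (rule abelian_group_subspace) (simp_all add: carrier_module_of_type[OF T] comb.subspace_span)
qed (use type_space_subset[OF T] type_space_closed[OF _ _ T] in
    \<open>auto simp: carrier_module_of_type[OF T] comb_mult_add_left comb_mult_add_right
      comb_mult_assoc algebra_unit_left\<close>)

text \<open>The coefficient of \<open>matrix_unit S T\<close> in \<open>f\<close>: multiplication by \<open>matrix_unit S S\<close> kills the
  other basis vectors of the column of \<open>T\<close>.\<close>

definition type_coeff :: "(nat \<Rightarrow> nat set) \<Rightarrow> (nat \<Rightarrow> nat set) \<Rightarrow> comb \<Rightarrow> complex" where
  "type_coeff T S f = Poly_Mapping.lookup (comb_mult (matrix_unit S S) f) (type_diagram S T)"

lemma type_coeff_add: "type_coeff T S (f + g) = type_coeff T S f + type_coeff T S g"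
  by (simp add: type_coeff_def comb_mult_add_right lookup_add)

lemma type_coeff_cscale: "type_coeff T S (cscale z f) = z * type_coeff T S f"
  by (simp add: type_coeff_def comb_mult_cscale_right)

lemma type_coeff_matrix_unit:
  assumes "T \<in> colour_types c n" "S \<in> colour_types c n" "S' \<in> types_like c n T"
  shows "type_coeff T S (matrix_unit S' T) = (if S = S' then 1 else 0)"
  using assms by (auto simp: type_coeff_def types_like_def matrix_unit_mult[of _ c n]
      lookup_matrix_unit[of _ c n])

text \<open>A coefficient is a number, whereas the facts of \<open>comb_pair\<close> concern maps
  between combinations. Scaling a fixed vector \<open>h\<close> turns the functional into such a
  map.\<close>

lemma linear_type_coeff_scale:
  "Vector_Spaces.linear cscale cscale (\<lambda>f. cscale (type_coeff T S f) h)"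
  by (intro Vector_Spaces.linear_iff[THEN iffD2] conjI allI)
    (simp_all add: comb.vector_space_axioms type_coeff_add type_coeff_cscale comb.scale_left_distrib)

lemma type_space_expand:
  assumes T: "T \<in> colour_types c n" and f: "f \<in> type_space c n T"
  shows "f = (\<Sum>S\<in>types_like c n T. cscale (type_coeff T S f) (matrix_unit S T))"
proof -
  have "b = (\<Sum>S\<in>types_like c n T. cscale (type_coeff T S b) (matrix_unit S T))"
    if "b \<in> (\<lambda>S. matrix_unit S T) ` types_like c n T" for b
  proof -
    from that obtain S' where S': "S' \<in> types_like c n T" "b = matrix_unit S' T" by blast
    have "(\<Sum>S\<in>types_like c n T. cscale (type_coeff T S b) (matrix_unit S T)) =
        (\<Sum>S\<in>types_like c n T. if S = S' then b else 0)"
      unfolding S'(2) using T S'(1)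
      by (intro sum.cong) (auto simp: type_coeff_matrix_unit[of _ c n] types_like_def[of c n T])
    then show ?thesis using S' by (simp add: finite_types_like)
  qed
  then show ?thesis
    using comb_pair.linear_eq_on[OF linear_ident _ f,
        of "\<lambda>f. \<Sum>S\<in>types_like c n T. cscale (type_coeff T S f) (matrix_unit S T)"]
      comb_pair.linear_compose_sum[of "types_like c n T"
        "\<lambda>S f. cscale (type_coeff T S f) (matrix_unit S T)"] linear_type_coeff_scale
    by blast
qed

text \<open>\<open>matrix_unit U S\<close> reads the entry of the column in row \<open>S\<close> and
  writes it into row \<open>U\<close>; irreducibility rests on this.\<close>

lemma matrix_unit_mult_type_space:
  assumes T: "T \<in> colour_types c n" and f: "f \<in> type_space c n T"
    and S: "S \<in> types_like c n T" and U: "U \<in> types_like c n T"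
  shows "comb_mult (matrix_unit U S) f = cscale (type_coeff T S f) (matrix_unit U T)"
proof -
  have "comb_mult (matrix_unit U S) b = cscale (type_coeff T S b) (matrix_unit U T)"
    if "b \<in> (\<lambda>S. matrix_unit S T) ` types_like c n T" for b
  proof -
    from that obtain S' where S': "S' \<in> types_like c n T" "b = matrix_unit S' T" by blast
    have "same_shape U S" using S U
      by (auto simp: types_like_def intro: same_shape_trans same_shape_sym)
    then show ?thesis
      using S' S U T type_coeff_matrix_unit[OF T _ S'(1), of S]
      by (auto simp: types_like_def matrix_unit_mult[of _ c n])
  qed
  then show ?thesis
    using comb_pair.linear_eq_on[OF linear_comb_mult_right linear_type_coeff_scale f] by blast
qed

lemma types_like_refl: "T \<in> colour_types c n \<Longrightarrow> T \<in> types_like c n T"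
  by (simp add: types_like_def)

text \<open>A nonzero vector of a submodule has a nonzero entry in some row \<open>S\<close>. The
  matrix units \<open>matrix_unit U S\<close> carry it to every row \<open>U\<close>, so the
  submodule contains the whole basis of the column.\<close>

lemma irreducible_module_of_type:
  assumes T: "T \<in> colour_types c n"
  shows "irreducible_module (diagram_algebra c n) (module_of_type c n T)"
  unfolding irreducible_module_def
proof (intro conjI allI impI)
  let ?M = "module_of_type c n T"
  show "left_module (diagram_algebra c n) ?M" by (rule left_module_of_type[OF T])
  have "matrix_unit T T \<in> type_space c n T"
    using types_like_refl[OF T] by (intro comb.span_base) auto
  then show "carrier ?M \<noteq> {\<zero>\<^bsub>?M\<^esub>}"
    using matrix_unit_nonzero[OF T T] by (auto simp: carrier_module_of_type[OF T])
  fix H assume H: "submodule H (diagram_algebra c n) ?M"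
  have smult: "comb_mult f x \<in> H" if "f \<in> diagram_carrier c n" "x \<in> H" for f x
    using submodule.smult_closed[OF H, of f x] that by simp
  interpret H: subgroup H "add_monoid ?M" using H by (rule submodule.axioms)
  have sub: "H \<subseteq> type_space c n T"
    using H.subset by (simp add: carrier_module_of_type[OF T])
  have subspace: "comb.subspace H"
  proof (rule comb.subspaceI)
    show "0 \<in> H" using H.one_closed by simp
    show "x + y \<in> H" if "x \<in> H" "y \<in> H" for x y using H.m_closed[OF that] by simp
    show "cscale z x \<in> H" if "x \<in> H" for z x
    proof -
      \<comment> \<open>A submodule is closed under the action of the algebra; scaling by
        \<open>z\<close> is the action of \<open>z\<close> times the unit.\<close>
      have "cscale z (algebra_unit c n) \<in> diagram_carrier c n"
        by (intro comb.subspace_scale subspace_diagram_carrier algebra_unit_in_carrier)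
      from smult[OF this that] have "cscale z (comb_mult (algebra_unit c n) x) \<in> H"
        by (simp only: comb_mult_cscale_left)
      moreover have "x \<in> diagram_carrier c n"
        by (rule subsetD[OF type_space_subset[OF T] subsetD[OF sub that]])
      ultimately show ?thesis by (simp add: algebra_unit_left)
    qed
  qed
  show "H = {\<zero>\<^bsub>?M\<^esub>} \<or> H = carrier ?M"
  proof (cases "H \<subseteq> {0}")
    case True
    then show ?thesis using comb.subspace_0[OF subspace] by auto
  next
    case False
    then obtain x where x: "x \<in> H" "x \<noteq> 0" by blast
    have "\<exists>S\<in>types_like c n T. type_coeff T S x \<noteq> 0"
    proof (rule ccontr)
      assume "\<not> ?thesis"
      then have "(\<Sum>S\<in>types_like c n T. cscale (type_coeff T S x) (matrix_unit S T)) = 0"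
        by (intro sum.neutral) auto
      then show False using type_space_expand[OF T, of x] x sub by auto
    qed
    then obtain S where S: "S \<in> types_like c n T" and nz: "type_coeff T S x \<noteq> 0" by blast
    have "matrix_unit U T \<in> H" if U: "U \<in> types_like c n T" for U
    proof -
      have "same_shape U S" using S U
        by (auto simp: types_like_def intro: same_shape_trans same_shape_sym)
      then have "matrix_unit U S \<in> diagram_carrier c n"
        using S U by (intro matrix_unit_in_carrier) (auto simp: types_like_def)
      from smult[OF this x(1)] have "cscale (type_coeff T S x) (matrix_unit U T) \<in> H"
        by (simp add: matrix_unit_mult_type_space[OF T subsetD[OF sub x(1)] S U])
      from comb.subspace_scale[OF subspace this, of "inverse (type_coeff T S x)"] show ?thesis
        using nz by simp
    qed
    then have "type_space c n T \<subseteq> H" by (intro comb.span_minimal subspace) auto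
    with sub show ?thesis by (simp add: carrier_module_of_type[OF T])
  qed
qed

section \<open>The embedding\<close>

definition extend_type :: "nat \<Rightarrow> nat \<Rightarrow> (nat \<Rightarrow> nat set) \<Rightarrow> nat \<Rightarrow> nat set" where
  "extend_type m j S = S(j := insert (Suc m) (S j))"

lemma extend_type_fresh: "S \<in> colour_types c m \<Longrightarrow> Suc m \<notin> S i"
  using colour_types_subset[of S c m i] by auto

lemma extend_type_in:
  assumes S: "S \<in> colour_types c m" and j: "j \<le> c"
  shows "extend_type m j S \<in> colour_types c (Suc m)"
  unfolding colour_types_def
proof (intro CollectI conjI allI impI)
  show "extend_type m j S i = {}" if "c < i" for i
    using that j colour_types_empty[OF S] by (simp add: extend_type_def)
  have "(\<Union>i\<le>c. extend_type m j S i) = insert (Suc m) (\<Union>i\<le>c. S i)"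
    using j by (auto simp: extend_type_def split: if_splits)
  then show "(\<Union>i\<le>c. extend_type m j S i) = {1..Suc m}"
    using S by (auto simp: colour_types_def)
  show "extend_type m j S i \<inter> extend_type m j S k = {}" if "i \<noteq> k" for i k
    using that extend_type_fresh[OF S] colour_types_disjoint[OF S]
    by (auto simp: extend_type_def)
qed

lemma extend_type_inject:
  assumes S: "S \<in> colour_types c m" and T: "T \<in> colour_types c m"
  shows "extend_type m i S = extend_type m j T \<longleftrightarrow> i = j \<and> S = T"
proof
  assume eq: "extend_type m i S = extend_type m j T"
  have "Suc m \<in> extend_type m j T i" unfolding eq[symmetric] by (simp add: extend_type_def)
  then have "i = j" using extend_type_fresh[OF T, of i] by (auto simp: extend_type_def split: if_splits)
  moreover have "S k = T k" for k
    using fun_cong[OF eq, of k] \<open>i = j\<close> extend_type_fresh[OF S, of k] extend_type_fresh[OF T, of k]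
    by (simp add: extend_type_def insert_ident split: if_splits)
  ultimately show "i = j \<and> S = T" by auto
qed simp

lemma extend_type_cases:
  assumes U: "U \<in> colour_types c (Suc m)"
  obtains j S where "j \<le> c" "S \<in> colour_types c m" "U = extend_type m j S"
proof -
  obtain j where j: "j \<le> c" "Suc m \<in> U j"
    using colour_types_cover[OF U, of "Suc m"] by auto
  define S where "S = (\<lambda>i. U i - {Suc m})"
  have "S \<in> colour_types c m"
    unfolding colour_types_def
  proof (intro CollectI conjI allI impI)
    show "S i = {}" if "c < i" for i
      using that colour_types_empty[OF U] by (simp add: S_def)
    have "(\<Union>i\<le>c. S i) = (\<Union>i\<le>c. U i) - {Suc m}" by (auto simp: S_def)
    then show "(\<Union>i\<le>c. S i) = {1..m}" using U by (auto simp: colour_types_def)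
    show "S i \<inter> S k = {}" if "i \<noteq> k" for i k
      using that colour_types_disjoint[OF U] by (auto simp: S_def)
  qed
  moreover have "U = extend_type m j S"
  proof
    fix k
    show "U k = extend_type m j S k"
    proof (cases "k = j")
      case True
      with j show ?thesis by (simp add: extend_type_def S_def insert_absorb)
    next
      case False
      then have "Suc m \<notin> U k" using j(2) colour_types_disjoint[OF U] by blast
      with False show ?thesis by (simp add: extend_type_def S_def)
    qed
  qed
  ultimately show thesis using that j by blast
qed

lemma card_extend_type:
  "S \<in> colour_types c m \<Longrightarrow> card (extend_type m j S i) = card (S i) + (if i = j then 1 else 0)"
  using extend_type_fresh[of S c m j] colour_types_finite[of S c m j] by (simp add: extend_type_def)

lemma same_shape_extend_type:
  assumes "S \<in> colour_types c m" "T \<in> colour_types c m"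
  shows "same_shape (extend_type m j S) (extend_type m j T) \<longleftrightarrow> same_shape S T"
  by (simp add: same_shape_def card_extend_type[OF assms(1)] card_extend_type[OF assms(2)])

text \<open>The inverse deletes the last vertex and remembers its label. This reindexing identifies
  the image of the unit under the embedding.\<close>

lemma bij_betw_extend_type:
  "bij_betw (\<lambda>(T, j). extend_type m j T) (colour_types c m \<times> {..c}) (colour_types c (Suc m))"
  unfolding bij_betw_def
proof
  show "inj_on (\<lambda>(T, j). extend_type m j T) (colour_types c m \<times> {..c})"
    by (rule inj_onI) (auto simp: extend_type_inject)
  show "(\<lambda>(T, j). extend_type m j T) ` (colour_types c m \<times> {..c}) = colour_types c (Suc m)"
    using extend_type_in by (fastforce elim: extend_type_cases)
qed

lemma rank_insert_old: "x \<le> y \<Longrightarrow> rank (insert y A) x = rank A x"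
  by (auto simp: rank_def intro: arg_cong[where f = card])

lemma rank_eq_card: "(\<And>y. y \<in> A \<Longrightarrow> y < x) \<Longrightarrow> rank A x = card A"
  by (auto simp: rank_def intro: arg_cong[where f = card])

lemma rank_less_card: "finite A \<Longrightarrow> x \<in> A \<Longrightarrow> rank A x < card A"
  unfolding rank_def by (rule psubset_card_mono) auto

text \<open>The new vertex is the largest of its class in both rows, so its rank is the old size of
  the class, which is the same above and below; old vertices keep their ranks. Hence the only new
  edge is the vertical one.\<close>

lemma type_diagram_extend:
  assumes S: "S \<in> colour_types c m" and T: "T \<in> colour_types c m" and ST: "same_shape S T"
    and j: "j \<noteq> 0"
  shows "type_diagram (extend_type m j S) (extend_type m j T) =
    insert (Suc m, Suc m, j) (type_diagram S T)"
proof -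
  have le: "x \<le> m" if "x \<in> S j \<or> x \<in> T j" for x
    using that colour_types_subset[OF S, of j] colour_types_subset[OF T, of j] by auto
  have old: "rank (insert (Suc m) A) x = rank A x" if "x \<le> m" for A x
    using that by (simp add: rank_insert_old)
  have new: "rank (insert (Suc m) (S j)) (Suc m) = card (S j)"
    "rank (insert (Suc m) (T j)) (Suc m) = card (S j)"
    using le ST by (auto simp: rank_insert_old rank_eq_card same_shape_def le_imp_less_Suc)
  have less: "rank (S j) x < card (S j)" if "x \<in> S j" for x
    using that rank_less_card colour_types_finite[OF S] by blast
  have less': "rank (T j) x < card (S j)" if "x \<in> T j" for x
    using that rank_less_card colour_types_finite[OF T] ST by (metis same_shape_def)
  have "(i, k, a) \<in> type_diagram (extend_type m j S) (extend_type m j T) \<longleftrightarrow>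
      (i, k, a) \<in> insert (Suc m, Suc m, j) (type_diagram S T)" for i k a
  proof (cases "a = j")
    case False
    then show ?thesis by (auto simp: type_diagram_def extend_type_def)
  next
    case True
    then show ?thesis
      using j old new less[of i] less'[of k] le extend_type_fresh[OF S, of j] extend_type_fresh[OF T, of j]
      by (cases "i = Suc m"; cases "k = Suc m")
        (auto simp: type_diagram_def extend_type_def dest: less_imp_neq)
  qed
  then show ?thesis by auto
qed

text \<open>A new isolated vertex leaves no trace in an edge set.\<close>

lemma type_diagram_extend_zero:
  "type_diagram (extend_type m 0 S) (extend_type m 0 T) = type_diagram S T"
  by (auto simp: type_diagram_def extend_type_def)

section \<open>The embedding on matrix units\<close>

lemma comb_concat_supersets:
  assumes "finite A" "Poly_Mapping.keys f \<subseteq> A"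
  shows "comb_concat m f e =
    (\<Sum>d\<in>A. Poly_Mapping.single (concat_right m d e) (Poly_Mapping.lookup f d))"
  unfolding comb_concat_def using assms by (intro sum.mono_neutral_left) (auto simp: in_keys_iff)

lemma linear_comb_concat: "Vector_Spaces.linear cscale cscale (\<lambda>f. comb_concat m f e)"
proof (intro Vector_Spaces.linear_iff[THEN iffD2] conjI allI comb.vector_space_axioms)
  fix f g :: comb
  let ?A = "Poly_Mapping.keys f \<union> Poly_Mapping.keys g"
  show "comb_concat m (f + g) e = comb_concat m f e + comb_concat m g e"
    using comb_concat_supersets[of ?A "f + g"] comb_concat_supersets[of ?A f]
      comb_concat_supersets[of ?A g] keys_add[of f g]
    by (simp add: lookup_add single_add sum.distrib)
next
  fix z and f :: comb
  show "comb_concat m (cscale z f) e = cscale z (comb_concat m f e)"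
    using comb_concat_supersets[of "Poly_Mapping.keys f" "cscale z f"]
    by (simp add: keys_cscale comb_concat_def comb.scale_sum_right)
qed

lemma linear_embedding: "Vector_Spaces.linear cscale cscale (embedding c m)"
proof -
  have "Vector_Spaces.linear cscale cscale (\<lambda>g. (\<Sum>i = 1..c. comb_concat m g (one_column i)) -
     cscale (of_nat c - 1) (comb_concat m g (one_column 0)))"
    by (intro comb_pair.linear_compose_sub comb_pair.linear_compose_sum
        comb_pair.linear_compose_scale_right ballI linear_comb_concat)
  then show ?thesis by (simp add: embedding_def[abs_def])
qed

lemma comb_concat_single:
  "comb_concat m (Poly_Mapping.single d z) e = Poly_Mapping.single (concat_right m d e) z"
  using comb_concat_supersets[of "{d}" "Poly_Mapping.single d z"] by simp

lemma comb_concat_empty: "comb_concat m g (one_column 0) = g"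
  by (simp add: comb_concat_def concat_right_def one_column_def flip: sum_single_lookup)

text \<open>The subsets of the enlarged diagram are split by the new edge. Those containing it give
  the concatenation with unchanged signs; the others give minus \<open>alternating d\<close>,
  because the enlarged diagram has one edge more.\<close>

lemma comb_concat_alternating:
  assumes d: "finite d" and e: "(Suc m, Suc m, i) \<notin> d" and i: "i \<noteq> 0"
  shows "comb_concat m (alternating d) (one_column i) =
    alternating (insert (Suc m, Suc m, i) d) + alternating d"
proof -
  let ?e = "(Suc m, Suc m, i)"
  let ?s = "\<lambda>a. Poly_Mapping.single a ((-1) ^ (card (insert ?e d) - card a) :: complex)"
  have "comb_concat m (alternating d) (one_column i) =
      (\<Sum>d'\<in>Pow d. comb_concat m (Poly_Mapping.single d' ((-1) ^ (card d - card d'))) (one_column i))"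
    unfolding alternating_def by (rule comb_pair.linear_sum[OF linear_comb_concat])
  also have "\<dots> = (\<Sum>d'\<in>Pow d. Poly_Mapping.single (insert ?e d') ((-1) ^ (card d - card d')))"
    using i by (simp add: comb_concat_single concat_right_def one_column_def)
  finally have 1: "comb_concat m (alternating d) (one_column i) = \<dots>" .
  have inj: "inj_on (insert ?e) (Pow d)"
    by (rule inj_on_insert_Pow[OF e])
  have "alternating (insert ?e d) = sum ?s (Pow d) + sum ?s (insert ?e ` Pow d)"
    unfolding alternating_def Pow_insert using d e by (intro sum.union_disjoint) auto
  also have "sum ?s (insert ?e ` Pow d) = (\<Sum>a\<in>Pow d. ?s (insert ?e a))"
    using inj by (simp add: sum.reindex)
  also have "\<dots> = (\<Sum>a\<in>Pow d. Poly_Mapping.single (insert ?e a) ((-1) ^ (card d - card a)))"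
  proof (rule sum.cong[OF refl])
    fix a assume "a \<in> Pow d"
    then have "finite a" "?e \<notin> a" using d e finite_subset by auto
    then show "?s (insert ?e a) = Poly_Mapping.single (insert ?e a) ((-1) ^ (card d - card a))"
      using d e by simp
  qed
  also have "sum ?s (Pow d) = - alternating d"
    unfolding alternating_def sum_negf[symmetric]
  proof (rule sum.cong[OF refl])
    fix a assume "a \<in> Pow d"
    then have "card a \<le> card d" using d card_mono by auto
    then show "?s a = - Poly_Mapping.single a ((-1) ^ (card d - card a))"
      using d e by (simp add: Suc_diff_le single_uminus)
  qed
  finally show ?thesis using 1 by simp
qed

lemma embedding_matrix_unit:
  assumes S: "S \<in> colour_types c m" and T: "T \<in> colour_types c m" and ST: "same_shape S T"
  shows "embedding c m (matrix_unit S T) =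
    (\<Sum>j\<le>c. matrix_unit (extend_type m j S) (extend_type m j T))"
proof -
  let ?d = "type_diagram S T"
  have d: "?d \<in> diagrams c m" by (rule type_diagram_in_diagrams[OF S T])
  have e: "(Suc m, Suc m, i) \<notin> ?d" for i using diagram_edge(2)[OF d] by fastforce
  have "comb_concat m (matrix_unit S T) (one_column i) =
      matrix_unit (extend_type m i S) (extend_type m i T) + matrix_unit S T" if "i \<in> {1..c}" for i
    using that comb_concat_alternating[OF diagram_finite[OF d] e, of i]
      type_diagram_extend[OF S T ST, of i] by (simp add: matrix_unit_def)
  then have "embedding c m (matrix_unit S T) =
      (\<Sum>i = 1..c. matrix_unit (extend_type m i S) (extend_type m i T) + matrix_unit S T) -
      cscale (of_nat c - 1) (matrix_unit S T)"
    by (simp add: embedding_def comb_concat_empty)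
  \<comment> \<open>The spare copies are written with \<open>cscale 1\<close> so that the scalars
    can be collected into c - (c - 1) = 1.\<close>
  also have "\<dots> = (\<Sum>i = 1..c. matrix_unit (extend_type m i S) (extend_type m i T))
      + ((\<Sum>i = 1..c. cscale 1 (matrix_unit S T)) - cscale (of_nat c - 1) (matrix_unit S T))"
    by (simp add: sum.distrib)
  also have "(\<Sum>i = 1..c. cscale 1 (matrix_unit S T)) - cscale (of_nat c - 1) (matrix_unit S T)
      = matrix_unit S T"
    unfolding comb.scale_sum_left[symmetric] comb.scale_left_diff_distrib[symmetric] by simp
  finally have "embedding c m (matrix_unit S T) =
      (\<Sum>i = 1..c. matrix_unit (extend_type m i S) (extend_type m i T)) + matrix_unit S T" .
  \<comment> \<open>The surviving spare copy is the summand with label 0.\<close>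
  moreover have "matrix_unit (extend_type m 0 S) (extend_type m 0 T) = matrix_unit S T"
    by (simp add: matrix_unit_def type_diagram_extend_zero)
  ultimately show ?thesis
    by (simp add: atMost_atLeast0 sum.atLeast_Suc_atMost add.commute)
qed

lemma matrix_unit_extend_mult:
  assumes "S \<in> colour_types c m" "T \<in> colour_types c m" "same_shape S T"
    and "S' \<in> colour_types c m" "i \<le> c" "j \<le> c"
    and "U \<in> colour_types c (Suc m)" "same_shape (extend_type m i S') U"
  shows "comb_mult (matrix_unit (extend_type m j S) (extend_type m j T))
      (matrix_unit (extend_type m i S') U) =
    (if j = i \<and> T = S' then matrix_unit (extend_type m i S) U else 0)"
  using assms by (auto simp: matrix_unit_mult[of _ c "Suc m"] extend_type_in
      same_shape_extend_type[of _ c m] extend_type_inject[of _ c m])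

text \<open>Only the summand whose label is that of the last vertex contributes. On rows with a
  fixed last label the smaller algebra therefore acts as on its own columns, whatever the column
  index \<open>U\<close>.\<close>

lemma embedding_matrix_unit_mult:
  assumes S: "S \<in> colour_types c m" "T \<in> colour_types c m" "same_shape S T"
    and S': "S' \<in> colour_types c m" and i: "i \<le> c"
    and U: "U \<in> colour_types c (Suc m)" "same_shape (extend_type m i S') U"
  shows "comb_mult (embedding c m (matrix_unit S T)) (matrix_unit (extend_type m i S') U) =
    (if T = S' then matrix_unit (extend_type m i S) U else 0)"
proof -
  have "comb_mult (embedding c m (matrix_unit S T)) (matrix_unit (extend_type m i S') U) =
      (\<Sum>j\<le>c. if j = i then (if T = S' then matrix_unit (extend_type m i S) U else 0) else 0)"
    unfolding embedding_matrix_unit[OF S] comb_mult_sum_left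
    by (intro sum.cong refl) (use assms in \<open>simp add: matrix_unit_extend_mult\<close>)
  then show ?thesis using i by simp
qed

lemma embedding_in_carrier:
  assumes "f \<in> diagram_carrier c m"
  shows "embedding c m f \<in> diagram_carrier c (Suc m)"
proof -
  have "comb.subspace {f. embedding c m f \<in> diagram_carrier c (Suc m)}"
    using comb_pair.linear_subspace_vimage[OF linear_embedding subspace_diagram_carrier]
    by (simp add: vimage_def)
  moreover have "embedding c m b \<in> diagram_carrier c (Suc m)" if "b \<in> matrix_units c m" for b
  proof -
    from that obtain S T where *: "b = matrix_unit S T"
      "S \<in> colour_types c m" "T \<in> colour_types c m" "same_shape S T" by blast
    then show ?thesis
      by (auto simp: embedding_matrix_unit same_shape_extend_type extend_type_in
          intro!: comb.subspace_sum subspace_diagram_carrier matrix_unit_in_carrier)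
  qed
  ultimately have "comb.span (matrix_units c m) \<subseteq> {f. embedding c m f \<in> diagram_carrier c (Suc m)}"
    by (intro comb.span_minimal) auto
  then show ?thesis using assms by (auto simp: diagram_carrier_span[of c m])
qed

lemma embedding_mult:
  assumes "f \<in> diagram_carrier c m" "g \<in> diagram_carrier c m"
  shows "embedding c m (comb_mult f g) = comb_mult (embedding c m f) (embedding c m g)"
proof (rule bilinear_eq_on[OF assms[unfolded diagram_carrier_span]])
  fix a b assume "a \<in> matrix_units c m" "b \<in> matrix_units c m"
  then obtain S T S' T' where *: "a = matrix_unit S T" "b = matrix_unit S' T'"
    "S \<in> colour_types c m" "T \<in> colour_types c m" "same_shape S T"
    "S' \<in> colour_types c m" "T' \<in> colour_types c m" "same_shape S' T'" by blast
  have "comb_mult (embedding c m a) (embedding c m b) =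
      (\<Sum>i\<le>c. if T = S' then matrix_unit (extend_type m i S) (extend_type m i T') else 0)"
    unfolding *(2) embedding_matrix_unit[OF *(6-8)] comb_mult_sum_right
    by (intro sum.cong refl) (use * in \<open>simp add: embedding_matrix_unit_mult extend_type_in same_shape_extend_type\<close>)
  also have "\<dots> = embedding c m (comb_mult a b)"
  proof (cases "T = S'")
    case True
    then have "same_shape S T'" using * by (auto intro: same_shape_trans)
    then show ?thesis using * True by (simp add: matrix_unit_mult[of _ c m] embedding_matrix_unit)
  next
    case False
    then show ?thesis
      using * comb_pair.linear_0[OF linear_embedding] by (simp add: matrix_unit_mult[of _ c m])
  qed
  finally show "embedding c m (comb_mult a b) = comb_mult (embedding c m a) (embedding c m b)" by simp
qed (use Vector_Spaces.linear_compose[OF linear_comb_mult_left linear_embedding]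
      Vector_Spaces.linear_compose[OF linear_comb_mult_right linear_embedding]
      Vector_Spaces.linear_compose[OF linear_embedding linear_comb_mult_left]
      Vector_Spaces.linear_compose[OF linear_embedding linear_comb_mult_right] in \<open>simp_all add: o_def\<close>)

lemma embedding_unit: "embedding c m (algebra_unit c m) = algebra_unit c (Suc m)"
proof -
  have "embedding c m (algebra_unit c m) =
      (\<Sum>T\<in>colour_types c m. \<Sum>j\<le>c. matrix_unit (extend_type m j T) (extend_type m j T))"
    unfolding algebra_unit_def comb_pair.linear_sum[OF linear_embedding]
    by (intro sum.cong refl embedding_matrix_unit) auto
  also have "\<dots> = (\<Sum>(T, j)\<in>colour_types c m \<times> {..c}.
      matrix_unit (extend_type m j T) (extend_type m j T))"
    by (rule sum.cartesian_product)
  also have "\<dots> = algebra_unit c (Suc m)"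
    unfolding algebra_unit_def
    using sum.reindex_bij_betw[OF bij_betw_extend_type, of "\<lambda>U. matrix_unit U U" m c]
    by (simp add: case_prod_unfold)
  finally show ?thesis .
qed

lemma embedding_ring_hom:
  "embedding c m \<in> ring_hom (diagram_algebra c m) (diagram_algebra c (Suc m))"
  by (rule ring_hom_memI) (simp_all add: embedding_in_carrier embedding_mult embedding_unit
      comb_pair.linear_add[OF linear_embedding])

section \<open>Constructions with left modules\<close>

lemma left_module_restrict_scalars:
  fixes R Q :: "('a, 'm) ring_scheme" and M :: "('a, 'b) module"
  assumes "left_module R M" "ring Q" "h \<in> ring_hom Q R"
  shows "left_module Q (restrict_scalars h M)"
proof -
  interpret M: left_module R M by (rule assms(1))
  have "add_monoid (restrict_scalars h M) = add_monoid M"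
    by (simp add: restrict_scalars_def)
  then have "abelian_group (restrict_scalars h M)"
    using M.M.abelian_group_axioms
    by (simp add: abelian_group_def abelian_monoid_def abelian_group_axioms_def)
  moreover have "h a \<in> carrier R" if "a \<in> carrier Q" for a
    using assms(3) that by (rule ring_hom_closed)
  ultimately show ?thesis
    using assms(2) ring_hom_add[OF assms(3)] ring_hom_mult[OF assms(3)] ring_hom_one[OF assms(3)]
    by (intro left_module.intro left_module_axioms.intro)
      (simp_all add: restrict_scalars_def M.smult_closed M.smult_l_distr M.smult_r_distr
        M.smult_assoc M.smult_one)
qed

lemma left_module_group:
  assumes "left_module R M"
  shows "group (add_monoid M)" "comm_group (add_monoid M)"
proof -
  interpret left_module R M by (rule assms)
  show "comm_group (add_monoid M)" by (rule M.a_comm_group)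
  then show "group (add_monoid M)" by (rule comm_group.axioms)
qed

lemma (in left_module) smult_zero:
  assumes "a \<in> carrier R"
  shows "a \<odot>\<^bsub>M\<^esub> \<zero>\<^bsub>M\<^esub> = \<zero>\<^bsub>M\<^esub>"
proof -
  have "a \<odot>\<^bsub>M\<^esub> \<zero>\<^bsub>M\<^esub> \<oplus>\<^bsub>M\<^esub> a \<odot>\<^bsub>M\<^esub> \<zero>\<^bsub>M\<^esub> = a \<odot>\<^bsub>M\<^esub> \<zero>\<^bsub>M\<^esub>"
    using smult_r_distr[OF assms M.zero_closed M.zero_closed] by simp
  then show ?thesis
    using smult_closed[OF assms M.zero_closed] by (simp add: M.add.r_cancel_one)
qed

lemma carrier_direct_sum:
  assumes "\<And>i. i \<in> I \<Longrightarrow> left_module R (N i)"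
  shows "carrier (direct_sum I N) =
    {x \<in> \<Pi>\<^sub>E i\<in>I. carrier (N i). finite {i \<in> I. x i \<noteq> \<zero>\<^bsub>N i\<^esub>}}"
  using carrier_sum_group[of I "\<lambda>i. add_monoid (N i)"] left_module_group(1)[OF assms]
  by (simp add: direct_sum_def)

lemma direct_sum_simps [simp]:
  "add (direct_sum I N) x y = (\<lambda>i\<in>I. x i \<oplus>\<^bsub>N i\<^esub> y i)"
  "zero (direct_sum I N) = (\<lambda>i\<in>I. \<zero>\<^bsub>N i\<^esub>)"
  "smult (direct_sum I N) a x = (\<lambda>i\<in>I. a \<odot>\<^bsub>N i\<^esub> x i)"
  by (simp_all add: direct_sum_def)

text \<open>\<open>sum_group\<close> carries the group laws, commutativity is checked in each
  component, and scalar multiples stay finitely supported because ring elements preserve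
  zero.\<close>

lemma left_module_direct_sum:
  assumes "ring R" and N: "\<And>i. i \<in> I \<Longrightarrow> left_module R (N i)"
  shows "left_module R (direct_sum I N)"
proof (intro left_module.intro left_module_axioms.intro assms(1))
  let ?S = "sum_group I (\<lambda>i. add_monoid (N i))"
  have grp: "group ?S" by (rule sum_group) (rule left_module_group(1)[OF N])
  have mem: "x i \<in> carrier (N i)" if "x \<in> carrier (direct_sum I N)" "i \<in> I" for x i
    using that by (auto simp: carrier_direct_sum[OF N])
  interpret S: group ?S by (rule grp)
  have S: "carrier (direct_sum I N) = carrier ?S" "zero (direct_sum I N) = one ?S"
    "add (direct_sum I N) = monoid.mult ?S"
    by (simp_all add: direct_sum_def del: one_sum_group mult_sum_group)
  show "abelian_group (direct_sum I N)"
  proof (rule abelian_groupI, unfold S)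
    fix x y assume "x \<in> carrier ?S" "y \<in> carrier ?S"
    then have "x \<in> carrier (direct_sum I N)" "y \<in> carrier (direct_sum I N)"
      by (simp_all add: direct_sum_def)
    then show "x \<otimes>\<^bsub>?S\<^esub> y = y \<otimes>\<^bsub>?S\<^esub> x"
      using comm_groupE(4)[OF left_module_group(2)[OF N]] mem
      by (auto intro!: restrict_ext)
  next
    fix x assume "x \<in> carrier ?S"
    then show "\<exists>y\<in>carrier ?S. y \<otimes>\<^bsub>?S\<^esub> x = \<one>\<^bsub>?S\<^esub>" by (rule S.l_inv_ex)
  qed (simp_all add: S.m_assoc del: one_sum_group mult_sum_group)
  show "a \<odot>\<^bsub>direct_sum I N\<^esub> x \<in> carrier (direct_sum I N)"
    if a: "a \<in> carrier R" and x: "x \<in> carrier (direct_sum I N)" for a x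
  proof -
    have "{i \<in> I. a \<odot>\<^bsub>N i\<^esub> x i \<noteq> \<zero>\<^bsub>N i\<^esub>} \<subseteq> {i \<in> I. x i \<noteq> \<zero>\<^bsub>N i\<^esub>}"
      using left_module.smult_zero[OF N a] by auto
    moreover have "finite {i \<in> I. x i \<noteq> \<zero>\<^bsub>N i\<^esub>}"
      using x by (simp add: carrier_direct_sum[OF N])
    ultimately have "finite {i \<in> I. a \<odot>\<^bsub>N i\<^esub> x i \<noteq> \<zero>\<^bsub>N i\<^esub>}" by (rule finite_subset)
    then show ?thesis
      using left_module.smult_closed[OF N a mem[OF x]]
      by (simp add: carrier_direct_sum[OF N] cong: conj_cong)
  qed
qed (auto simp: carrier_direct_sum[OF N] PiE_iff extensional_def fun_eq_iff
    left_module.smult_l_distr[OF N] left_module.smult_r_distr[OF N]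
    left_module.smult_assoc[OF N] left_module.smult_one[OF N])

lemma isomorphic_modules_refl: "left_module R M \<Longrightarrow> isomorphic_modules R M M"
  unfolding isomorphic_modules_def by (auto intro!: bexI[OF _ iso_set_refl])

lemma isomorphic_modules_sym:
  assumes "isomorphic_modules R M N"
  shows "isomorphic_modules R N M"
proof -
  from assms obtain h where M: "left_module R M" and N: "left_module R N"
    and h: "h \<in> iso (add_monoid M) (add_monoid N)"
    and hs: "\<And>a x. a \<in> carrier R \<Longrightarrow> x \<in> carrier M \<Longrightarrow> h (a \<odot>\<^bsub>M\<^esub> x) = a \<odot>\<^bsub>N\<^esub> h x"
    by (auto simp: isomorphic_modules_def)
  let ?g = "inv_into (carrier M) h"
  have bij: "bij_betw h (carrier M) (carrier N)" using h by (simp add: iso_def)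
  have "?g (a \<odot>\<^bsub>N\<^esub> y) = a \<odot>\<^bsub>M\<^esub> ?g y" if a: "a \<in> carrier R" and y: "y \<in> carrier N" for a y
  proof -
    have g: "?g y \<in> carrier M" "h (?g y) = y"
      using bij y by (auto simp: bij_betw_def inv_into_into f_inv_into_f)
    then have "a \<odot>\<^bsub>N\<^esub> y = h (a \<odot>\<^bsub>M\<^esub> ?g y)" using hs[OF a g(1)] by simp
    moreover have "a \<odot>\<^bsub>M\<^esub> ?g y \<in> carrier M" by (rule left_module.smult_closed[OF M a g(1)])
    ultimately show ?thesis using bij by (simp add: bij_betw_def inv_into_f_f)
  qed
  moreover have "?g \<in> iso (add_monoid N) (add_monoid M)"
    using group.iso_set_sym[OF left_module_group(1)[OF M] h] by simp
  ultimately show ?thesis using M N by (auto simp: isomorphic_modules_def)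
qed

text \<open>The invariant that tells summands apart: an isomorphism commutes with \<open>e\<close>
  and, being injective, keeps a fixed vector nonzero.\<close>

lemma isomorphic_modules_fixed:
  assumes "isomorphic_modules R M N" "e \<in> carrier R"
    and "x \<in> carrier M" "x \<noteq> \<zero>\<^bsub>M\<^esub>" "e \<odot>\<^bsub>M\<^esub> x = x"
  shows "\<exists>y\<in>carrier N. y \<noteq> \<zero>\<^bsub>N\<^esub> \<and> e \<odot>\<^bsub>N\<^esub> y = y"
proof -
  from assms(1) obtain h where M: "left_module R M" and N: "left_module R N"
    and h: "h \<in> iso (add_monoid M) (add_monoid N)"
    and hs: "\<And>a x. a \<in> carrier R \<Longrightarrow> x \<in> carrier M \<Longrightarrow> h (a \<odot>\<^bsub>M\<^esub> x) = a \<odot>\<^bsub>N\<^esub> h x"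
    by (auto simp: isomorphic_modules_def)
  have bij: "bij_betw h (carrier M) (carrier N)" using h by (simp add: iso_def)
  have z: "h \<zero>\<^bsub>M\<^esub> = \<zero>\<^bsub>N\<^esub>" "\<zero>\<^bsub>M\<^esub> \<in> carrier M"
    using hom_one[OF iso_imp_homomorphism[OF h] left_module_group(1)[OF M] left_module_group(1)[OF N]]
      group.is_monoid[OF left_module_group(1)[OF M]] monoid.one_closed by fastforce+
  have "h x \<noteq> \<zero>\<^bsub>N\<^esub>"
    using bij assms(3,4) z by (metis bij_betw_def inj_onD)
  moreover have "h x \<in> carrier N" using bij assms(3) by (auto simp: bij_betw_def)
  moreover have "e \<odot>\<^bsub>N\<^esub> h x = h x" using hs[OF assms(2,3)] assms(5) by simp
  ultimately show ?thesis by blast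
qed

text \<open>The vector is extended by zero outside coordinate \<open>i\<close>; its support is
  finite and \<open>e\<close> preserves the zeros.\<close>

lemma direct_sum_fixed:
  assumes N: "\<And>k. k \<in> I \<Longrightarrow> left_module R (N k)" and e: "e \<in> carrier R" and i: "i \<in> I"
    and y: "y \<in> carrier (N i)" "y \<noteq> \<zero>\<^bsub>N i\<^esub>" "e \<odot>\<^bsub>N i\<^esub> y = y"
  shows "\<exists>z\<in>carrier (direct_sum I N). z \<noteq> \<zero>\<^bsub>direct_sum I N\<^esub> \<and> e \<odot>\<^bsub>direct_sum I N\<^esub> z = z"
proof
  let ?z = "\<lambda>k\<in>I. if k = i then y else \<zero>\<^bsub>N k\<^esub>"
  have zc: "\<zero>\<^bsub>N k\<^esub> \<in> carrier (N k)" if "k \<in> I" for k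
    using monoid.one_closed[OF group.is_monoid[OF left_module_group(1)[OF N[OF that]]]] by simp
  have "finite {k \<in> I. ?z k \<noteq> \<zero>\<^bsub>N k\<^esub>}"
    by (rule finite_subset[of _ "{i}"]) auto
  then show "?z \<in> carrier (direct_sum I N)"
    using zc y by (auto simp: carrier_direct_sum[OF N])
  show "?z \<noteq> \<zero>\<^bsub>direct_sum I N\<^esub> \<and> e \<odot>\<^bsub>direct_sum I N\<^esub> ?z = ?z"
  proof
    show "?z \<noteq> \<zero>\<^bsub>direct_sum I N\<^esub>"
    proof
      assume "?z = \<zero>\<^bsub>direct_sum I N\<^esub>"
      from fun_cong[OF this, of i] show False using i y by simp
    qed
    show "e \<odot>\<^bsub>direct_sum I N\<^esub> ?z = ?z"
      using y left_module.smult_zero[OF N e] by (auto simp: fun_eq_iff)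
  qed
qed

section \<open>Representatives of the isomorphism classes\<close>

text \<open>Names the choice hidden in \<open>irrep\<close>, so that its properties can be
  stated.\<close>

definition rep_type :: "nat \<Rightarrow> nat \<Rightarrow> (nat \<Rightarrow> nat) \<Rightarrow> nat \<Rightarrow> nat set" where
  "rep_type c n ns = (SOME T. T \<in> bottom_types c n \<and> (\<forall>i\<le>c. card (T i) = ns i))"

lemma irrep_rep_type: "irrep c n ns = module_of_type c n (rep_type c n ns)"
  by (simp add: irrep_def rep_type_def)

lemma composition_decrease:
  assumes "ns \<in> compositions c (Suc m)" "j \<le> c" "ns j \<noteq> 0"
  shows "ns(j := ns j - 1) \<in> compositions c m"
proof -
  have "(\<Sum>i\<le>c. ns i) = ns j + (\<Sum>i\<in>{..c} - {j}. ns i)"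
    using assms(2) by (simp add: sum.remove)
  moreover have "(\<Sum>i\<le>c. (ns(j := ns j - 1)) i) = (ns j - 1) + (\<Sum>i\<in>{..c} - {j}. ns i)"
    using assms(2) by (simp add: sum.remove[of _ j])
  ultimately show ?thesis using assms by (auto simp: compositions_def)
qed

lemma composition_positive:
  assumes "ns \<in> compositions c (Suc m)"
  obtains j where "j \<le> c" "ns j \<noteq> 0"
proof -
  have "(\<Sum>i\<le>c. ns i) \<noteq> 0" using assms by (simp add: compositions_def)
  then show thesis using that by (auto simp: sum_eq_0_iff)
qed

lemma colour_types_0: "colour_types c 0 = {\<lambda>_. {}}"
proof
  show "colour_types c 0 \<subseteq> {\<lambda>_. {}}"
    using colour_types_subset[of _ c 0] by (auto simp: fun_eq_iff)
qed (auto simp: colour_types_def)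

text \<open>These amount to the words of length \<open>n\<close> in the letters 0 to
  \<open>c\<close> with prescribed multiplicities. They index the rows of a column, so their number
  is the dimension.\<close>

definition types_of :: "nat \<Rightarrow> nat \<Rightarrow> (nat \<Rightarrow> nat) \<Rightarrow> (nat \<Rightarrow> nat set) set" where
  "types_of c n ns = {T \<in> colour_types c n. \<forall>i. card (T i) = ns i}"

lemma composition_0: "ns \<in> compositions c 0 \<Longrightarrow> ns i = 0"
  by (cases "i \<le> c") (auto simp: compositions_def)

lemma types_of_0: "ns \<in> compositions c 0 \<Longrightarrow> types_of c 0 ns = {\<lambda>_. {}}"
  by (auto simp: types_of_def colour_types_0 composition_0)

lemma extend_type_in_types_of:
  assumes S: "S \<in> colour_types c m" and "j \<le> c"
  shows "extend_type m j S \<in> types_of c (Suc m) ns \<longleftrightarrow> ns j \<noteq> 0 \<and> S \<in> types_of c m (ns(j := ns j - 1))"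
  using assms extend_type_in[OF assms] card_extend_type[OF S, of j]
  by (auto simp: types_of_def split: if_splits)

text \<open>Words are sorted by their last letter: Pascal's recursion for multinomial coefficients
  before taking cardinalities.\<close>

lemma types_of_Suc:
  "types_of c (Suc m) ns =
     (\<Union>j\<in>{j. j \<le> c \<and> ns j \<noteq> 0}. extend_type m j ` types_of c m (ns(j := ns j - 1)))"
proof (intro equalityI subsetI)
  fix U assume U: "U \<in> types_of c (Suc m) ns"
  then have "U \<in> colour_types c (Suc m)" by (simp add: types_of_def)
  then obtain j S where j: "j \<le> c" and S: "S \<in> colour_types c m" and eq: "U = extend_type m j S"
    by (rule extend_type_cases)
  have "ns j \<noteq> 0" "S \<in> types_of c m (ns(j := ns j - 1))"
    using U extend_type_in_types_of[OF S j, of ns] by (simp_all add: eq)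
  with j eq show "U \<in> (\<Union>j\<in>{j. j \<le> c \<and> ns j \<noteq> 0}. extend_type m j ` types_of c m (ns(j := ns j - 1)))"
    by (intro UN_I[of j]) auto
next
  fix U assume "U \<in> (\<Union>j\<in>{j. j \<le> c \<and> ns j \<noteq> 0}. extend_type m j ` types_of c m (ns(j := ns j - 1)))"
  then obtain j S where j: "j \<le> c" "ns j \<noteq> 0" and S: "S \<in> types_of c m (ns(j := ns j - 1))"
    and "U = extend_type m j S" by blast
  moreover have "S \<in> colour_types c m" using S by (simp add: types_of_def)
  ultimately show "U \<in> types_of c (Suc m) ns" by (simp add: extend_type_in_types_of)
qed

text \<open>Guarantees that the choice in \<open>irrep\<close> succeeds: a word is built by
  appending a letter of positive multiplicity.\<close>

lemma types_of_nonempty: "ns \<in> compositions c n \<Longrightarrow> types_of c n ns \<noteq> {}"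
proof (induction n arbitrary: ns)
  case 0
  then show ?case by (simp add: types_of_0)
next
  case (Suc m)
  from Suc.prems obtain j where "j \<le> c" "ns j \<noteq> 0" by (rule composition_positive)
  moreover from this Suc.IH[OF composition_decrease[OF Suc.prems]]
  obtain S where "S \<in> types_of c m (ns(j := ns j - 1))" by blast
  moreover from this have "S \<in> colour_types c m" by (simp add: types_of_def)
  ultimately have "extend_type m j S \<in> types_of c (Suc m) ns"
    by (simp add: extend_type_in_types_of)
  then show ?case by blast
qed

lemma rep_type_in:
  assumes "ns \<in> compositions c n"
  shows "rep_type c n ns \<in> types_of c n ns"
proof -
  obtain T where "T \<in> types_of c n ns" using types_of_nonempty[OF assms] by blast
  then have "\<exists>T. T \<in> bottom_types c n \<and> (\<forall>i\<le>c. card (T i) = ns i)"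
    by (auto simp: types_of_def bottom_types_eq)
  then have *: "rep_type c n ns \<in> bottom_types c n \<and> (\<forall>i\<le>c. card (rep_type c n ns i) = ns i)"
    unfolding rep_type_def by (rule someI_ex)
  then have "rep_type c n ns \<in> colour_types c n" by (simp add: bottom_types_eq)
  moreover have "card (rep_type c n ns i) = ns i" for i
  \<comment> \<open>The choice prescribes cardinalities up to \<open>c\<close> only; above
    \<open>c\<close> the class is empty and the tuple vanishes.\<close>
  proof (cases "i \<le> c")
    case False
    then show ?thesis
      using assms colour_types_empty[OF calculation, of i] by (simp add: compositions_def)
  qed (use * in simp)
  ultimately show ?thesis by (simp add: types_of_def)
qed

lemma rep_type_colour: "ns \<in> compositions c n \<Longrightarrow> rep_type c n ns \<in> colour_types c n"
  using rep_type_in by (simp add: types_of_def)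

lemma types_like_eq: "T \<in> types_of c n ns \<Longrightarrow> types_like c n T = types_of c n ns"
  by (auto simp: types_like_def types_of_def same_shape_def)

lemma irreducible_irrep:
  "ns \<in> compositions c n \<Longrightarrow> irreducible_module (diagram_algebra c n) (irrep c n ns)"
  by (simp add: irrep_rep_type irreducible_module_of_type rep_type_colour)

text \<open>Right multiplication by \<open>matrix_unit ?T ?T\<close> fixes the whole column of
  \<open>?T\<close>. If this column contains \<open>matrix_unit ?S ?S\<close>, the product of the
  two diagonal units is nonzero, which forces \<open>?S = ?T\<close>. Equality of modules, not
  isomorphism, is at stake: it keeps the vertices of one level distinct.\<close>

lemma irrep_inject:
  assumes "ns \<in> compositions c n" "ms \<in> compositions c n" "irrep c n ns = irrep c n ms"
  shows "ns = ms"
proof -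
  let ?S = "rep_type c n ns" and ?T = "rep_type c n ms"
  have S: "?S \<in> colour_types c n" and T: "?T \<in> colour_types c n"
    using assms(1,2) by (auto intro: rep_type_colour)
  have "type_space c n ?S = type_space c n ?T"
    using arg_cong[OF assms(3), of carrier] S T by (simp add: irrep_rep_type carrier_module_of_type)
  moreover have "matrix_unit ?S ?S \<in> type_space c n ?S"
    using types_like_refl[OF S] by (intro comb.span_base) auto
  ultimately have mem: "matrix_unit ?S ?S \<in> type_space c n ?T" by simp
  have fixed: "comb_mult b (matrix_unit ?T ?T) = b"
    if "b \<in> (\<lambda>S. matrix_unit S ?T) ` types_like c n ?T" for b
    using that T by (auto simp: types_like_def matrix_unit_mult[of _ c n])
  have "comb_mult (matrix_unit ?S ?S) (matrix_unit ?T ?T) = matrix_unit ?S ?S"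
    by (rule comb_pair.linear_eq_on[OF linear_comb_mult_left linear_ident mem fixed])
  then have "?S = ?T"
    using S T matrix_unit_nonzero[OF S S] by (auto simp: matrix_unit_mult[of _ c n] split: if_splits)
  then show ?thesis
    using rep_type_in[OF assms(1)] rep_type_in[OF assms(2)] by (auto simp: types_of_def fun_eq_iff)
qed

section \<open>Dimensions\<close>

lemma finite_types_of: "finite (types_of c n ns)"
  using finite_colour_types by (simp add: types_of_def)

lemma card_types_of_Suc:
  "card (types_of c (Suc m) ns) =
     (\<Sum>j\<in>{j. j \<le> c \<and> ns j \<noteq> 0}. card (types_of c m (ns(j := ns j - 1))))"
proof -
  let ?J = "{j. j \<le> c \<and> ns j \<noteq> 0}"
  have sub: "S \<in> colour_types c m" if "S \<in> types_of c m ms" for S ms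
    using that by (simp add: types_of_def)
  have "card (types_of c (Suc m) ns) =
      (\<Sum>j\<in>?J. card (extend_type m j ` types_of c m (ns(j := ns j - 1))))"
    unfolding types_of_Suc
  proof (rule card_UN_disjoint)
    show "\<forall>i\<in>?J. \<forall>j\<in>?J. i \<noteq> j \<longrightarrow> extend_type m i ` types_of c m (ns(i := ns i - 1)) \<inter>
        extend_type m j ` types_of c m (ns(j := ns j - 1)) = {}"
      using extend_type_inject[OF sub sub] by blast
  qed (simp_all add: finite_types_of)
  also have "\<dots> = (\<Sum>j\<in>?J. card (types_of c m (ns(j := ns j - 1))))"
    using extend_type_inject[OF sub sub] by (intro sum.cong refl card_image inj_onI) blast
  finally show ?thesis .
qed

text \<open>The multinomial formula is multiplied out so that the induction involves no division:
  last letter \<open>j\<close> contributes \<open>ns j * fact m\<close>, and the \<open>ns j\<close>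
  add up to \<open>Suc m\<close>.\<close>

lemma card_types_of:
  "ns \<in> compositions c n \<Longrightarrow> card (types_of c n ns) * (\<Prod>i\<le>c. fact (ns i)) = fact n"
proof (induction n arbitrary: ns)
  case 0
  have "(\<Prod>i\<le>c. fact (ns i)) = (1::nat)"
    by (intro prod.neutral) (auto simp: composition_0[OF 0])
  then show ?case by (simp add: types_of_0[OF 0])
next
  case (Suc m)
  let ?J = "{j. j \<le> c \<and> ns j \<noteq> 0}"
  have step: "card (types_of c m (ns(j := ns j - 1))) * (\<Prod>i\<le>c. fact (ns i)) = ns j * fact m"
    if "j \<in> ?J" for j
  proof -
    let ?ms = "ns(j := ns j - 1)"
    have j: "j \<le> c" "ns j \<noteq> 0" using that by auto
    have "(\<Prod>i\<le>c. fact (ns i)) = fact (ns j) * (\<Prod>i\<in>{..c} - {j}. fact (ns i) :: nat)"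
      using j by (simp add: prod.remove)
    also have "fact (ns j) = ns j * fact (ns j - 1)"
      using j by (simp add: fact_reduce)
    also have "(\<Prod>i\<in>{..c} - {j}. fact (ns i)) = (\<Prod>i\<in>{..c} - {j}. fact (?ms i) :: nat)"
      by (intro prod.cong) auto
    also have "ns j * fact (ns j - 1) * \<dots> = ns j * (\<Prod>i\<le>c. fact (?ms i))"
      using j by (simp add: prod.remove[of "{..c}" j] mult.assoc)
    finally have "card (types_of c m ?ms) * (\<Prod>i\<le>c. fact (ns i)) =
        ns j * (card (types_of c m ?ms) * (\<Prod>i\<le>c. fact (?ms i)))"
      by (simp only: mult.left_commute)
    also have "card (types_of c m ?ms) * (\<Prod>i\<le>c. fact (?ms i)) = fact m"
      by (rule Suc.IH[OF composition_decrease[OF Suc.prems j]])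
    finally show ?thesis .
  qed
  have "card (types_of c (Suc m) ns) * (\<Prod>i\<le>c. fact (ns i)) = (\<Sum>j\<in>?J. ns j * fact m)"
    unfolding card_types_of_Suc sum_distrib_right by (intro sum.cong refl step)
  \<comment> \<open>Letters of multiplicity 0 contribute nothing, so all labels may be
    summed.\<close>
  also have "\<dots> = (\<Sum>j\<le>c. ns j * fact m)"
    by (intro sum.mono_neutral_left) auto
  also have "\<dots> = fact (Suc m)"
    using Suc.prems by (simp add: compositions_def flip: sum_distrib_right)
  finally show ?case .
qed

lemma type_coeff_sum: "type_coeff T S (\<Sum>i\<in>I. f i) = (\<Sum>i\<in>I. type_coeff T S (f i))"
  by (simp add: type_coeff_def comb_mult_sum_right lookup_sum)

lemma matrix_unit_inj_on:
  assumes T: "T \<in> colour_types c n"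
  shows "inj_on (\<lambda>S. matrix_unit S T) (types_like c n T)"
proof (rule inj_onI)
  fix S S' assume *: "S \<in> types_like c n T" "S' \<in> types_like c n T" "matrix_unit S T = matrix_unit S' T"
  have "S \<in> colour_types c n" using *(1) by (simp add: types_like_def)
  with * show "S = S'"
    using type_coeff_matrix_unit[OF T _ *(1), of S] type_coeff_matrix_unit[OF T _ *(2), of S]
    by (auto split: if_splits)
qed

text \<open>The functionals \<open>type_coeff T S\<close> are dual to the spanning matrix units,
  which are therefore independent.\<close>

lemma dim_type_space:
  assumes T: "T \<in> colour_types c n"
  shows "comb.dim (type_space c n T) = card (types_like c n T)"
proof -
  let ?B = "(\<lambda>S. matrix_unit S T) ` types_like c n T"
  have "comb.independent ?B"
  proof (rule comb.independent_if_scalars_zero)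
    fix f x assume sum0: "(\<Sum>x\<in>?B. cscale (f x) x) = 0" and "x \<in> ?B"
    then obtain S where S: "S \<in> types_like c n T" "x = matrix_unit S T" by blast
    have "type_coeff T S (matrix_unit S' T) = (if S' = S then 1 else 0)"
      if "S' \<in> types_like c n T" for S'
      using type_coeff_matrix_unit[OF T _ that, of S] S(1) by (auto simp: types_like_def)
    then have "type_coeff T S (\<Sum>x\<in>?B. cscale (f x) x) =
        (\<Sum>S'\<in>types_like c n T. if S' = S then f (matrix_unit S' T) else 0)"
      unfolding sum.reindex[OF matrix_unit_inj_on[OF T]] type_coeff_sum
      by (intro sum.cong) (auto simp: type_coeff_cscale)
    also have "\<dots> = f x" using S by (simp add: finite_types_like)
    finally show "f x = 0" using sum0 by (simp add: type_coeff_def)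
  qed (simp add: finite_types_like)
  then have "comb.dim (type_space c n T) = card ?B"
    by (rule comb.dim_span_eq_card_independent)
  then show ?thesis using matrix_unit_inj_on[OF T] by (simp add: card_image)
qed

lemma dim_irrep:
  assumes "ns \<in> compositions c n"
  shows "comb.dim (carrier (irrep c n ns)) = multinomial c ns"
proof -
  have "comb.dim (carrier (irrep c n ns)) = card (types_of c n ns)"
    using dim_type_space[OF rep_type_colour[OF assms]] types_like_eq[OF rep_type_in[OF assms]]
    by (simp add: irrep_rep_type carrier_module_of_type[OF rep_type_colour[OF assms]])
  moreover have "multinomial c ns = card (types_of c n ns)"
  proof -
    have "(\<Sum>i\<le>c. ns i) = n" using assms by (simp add: compositions_def)
    \<comment> \<open>\<open>multinomial\<close> divides natural numbers; by
      \<open>card_types_of\<close> the division is exact.\<close>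
    moreover have "(\<Prod>i\<le>c. fact (ns i) :: nat) \<noteq> 0" by simp
    ultimately show ?thesis
      unfolding multinomial_def using card_types_of[OF assms, symmetric]
      by (metis nonzero_mult_div_cancel_right)
  qed
  ultimately show ?thesis by simp
qed

section \<open>Branching\<close>

text \<open>Projection onto the summand of label \<open>j\<close>: entries of rows with last label
  \<open>j\<close> are kept and that vertex is forgotten. The column index \<open>T\<close> is
  exchanged for \<open>U\<close>, and \<open>unbranch\<close> is the matching injection.\<close>

definition branch ::
    "nat \<Rightarrow> nat \<Rightarrow> (nat \<Rightarrow> nat set) \<Rightarrow> nat \<Rightarrow> (nat \<Rightarrow> nat set) \<Rightarrow> comb \<Rightarrow> comb" where
  "branch c m T j U f =
     (\<Sum>S\<in>types_like c m U. cscale (type_coeff T (extend_type m j S) f) (matrix_unit S U))"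

definition unbranch ::
    "nat \<Rightarrow> nat \<Rightarrow> (nat \<Rightarrow> nat set) \<Rightarrow> nat \<Rightarrow> (nat \<Rightarrow> nat set) \<Rightarrow> comb \<Rightarrow> comb" where
  "unbranch c m T j U g =
     (\<Sum>S\<in>types_like c m U. cscale (type_coeff U S g) (matrix_unit (extend_type m j S) T))"

lemma linear_branch: "Vector_Spaces.linear cscale cscale (branch c m T j U)"
  unfolding branch_def[abs_def]
  by (intro comb_pair.linear_compose_sum ballI linear_type_coeff_scale)

lemma linear_unbranch: "Vector_Spaces.linear cscale cscale (unbranch c m T j U)"
  unfolding unbranch_def[abs_def]
  by (intro comb_pair.linear_compose_sum ballI linear_type_coeff_scale)

lemma linear_zero: "Vector_Spaces.linear cscale cscale (\<lambda>_. 0)"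
  by (intro Vector_Spaces.linear_iff[THEN iffD2] conjI allI) (simp_all add: comb.vector_space_axioms)

lemma branch_in: "branch c m T j U f \<in> type_space c m U"
  unfolding branch_def by (intro comb.span_sum comb.span_scale comb.span_base imageI)

text \<open>The types \<open>U j\<close> are constrained by shape alone, so that the independently
  chosen representatives of both levels fit.\<close>

locale branching =
  fixes c m :: nat and T :: "nat \<Rightarrow> nat set" and U :: "nat \<Rightarrow> nat \<Rightarrow> nat set" and J :: "nat set"
  assumes T: "T \<in> colour_types c (Suc m)"
    and J: "J = {j. j \<le> c \<and> T j \<noteq> {}}"
    and U: "j \<in> J \<Longrightarrow> U j \<in> colour_types c m"
    and U_shape: "j \<in> J \<Longrightarrow> same_shape (extend_type m j (U j)) T"
begin

lemma finite_J: "finite J"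
  by (simp add: J)

lemma J_le: "j \<in> J \<Longrightarrow> j \<le> c"
  by (simp add: J)

lemma extend_in:
  assumes j: "j \<in> J" and S: "S \<in> types_like c m (U j)"
  shows "extend_type m j S \<in> types_like c (Suc m) T"
proof -
  have "same_shape (extend_type m j S) (extend_type m j (U j))"
    using S U[OF j] by (simp add: types_like_def same_shape_extend_type[of _ c m])
  then show ?thesis
    using S j U_shape[OF j] by (auto simp: types_like_def extend_type_in J intro: same_shape_trans)
qed

text \<open>The last vertex of a row has some label \<open>j\<close>. Equal shape makes
  \<open>T j\<close> nonempty, so \<open>j\<close> lies in \<open>J\<close>, and removing the vertex
  leaves the shape of \<open>U j\<close>.\<close>

lemma extend_exhaust:
  assumes S: "S \<in> types_like c (Suc m) T"
  obtains j S' where "j \<in> J" "S' \<in> types_like c m (U j)" "S = extend_type m j S'"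
proof -
  have S': "S \<in> colour_types c (Suc m)" "same_shape S T" using S by (auto simp: types_like_def)
  from S'(1) obtain j S' where *: "j \<le> c" "S' \<in> colour_types c m" "S = extend_type m j S'"
    by (rule extend_type_cases)
  have "card (T j) = card (S' j) + 1"
    using S'(2) card_extend_type[OF *(2), of j j] *(3) by (simp add: same_shape_def)
  then have j: "j \<in> J" using *(1) by (auto simp: J)
  have "same_shape (extend_type m j S') (extend_type m j (U j))"
    using U_shape[OF j] S'(2) *(3) by (auto intro: same_shape_trans same_shape_sym)
  then have "S' \<in> types_like c m (U j)"
    using *(2) U[OF j] by (simp add: types_like_def same_shape_extend_type[of _ c m])
  then show thesis using that j *(3) by blast
qed

lemma branch_matrix_unit:
  assumes i: "i \<in> J" and j: "j \<in> J" and S: "S \<in> types_like c m (U i)"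
  shows "branch c m T j (U j) (matrix_unit (extend_type m i S) T) =
    (if i = j then matrix_unit S (U j) else 0)"
proof -
  have Sc: "S \<in> colour_types c m" using S by (simp add: types_like_def)
  have coeff: "type_coeff T (extend_type m j S') (matrix_unit (extend_type m i S) T) =
      (if i = j \<and> S' = S then 1 else 0)" if "S' \<in> types_like c m (U j)" for S'
  proof -
    have "extend_type m j S' \<in> colour_types c (Suc m)" "S' \<in> colour_types c m"
      using extend_in[OF j that] that by (auto simp: types_like_def)
    then show ?thesis
      using type_coeff_matrix_unit[OF T _ extend_in[OF i S]] extend_type_inject[OF _ Sc] by auto
  qed
  have "branch c m T j (U j) (matrix_unit (extend_type m i S) T) =
      (\<Sum>S'\<in>types_like c m (U j). if S' = S then (if i = j then matrix_unit S (U j) else 0) else 0)"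
    unfolding branch_def by (intro sum.cong) (auto simp: coeff)
  then show ?thesis using S by (auto simp: finite_types_like)
qed

lemma unbranch_matrix_unit:
  assumes j: "j \<in> J" and S: "S \<in> types_like c m (U j)"
  shows "unbranch c m T j (U j) (matrix_unit S (U j)) = matrix_unit (extend_type m j S) T"
proof -
  have "unbranch c m T j (U j) (matrix_unit S (U j)) =
      (\<Sum>S'\<in>types_like c m (U j). if S' = S then matrix_unit (extend_type m j S) T else 0)"
    unfolding unbranch_def
  proof (intro sum.cong refl)
    fix S' assume "S' \<in> types_like c m (U j)"
    then have "S' \<in> colour_types c m" by (simp add: types_like_def)
    then show "cscale (type_coeff (U j) S' (matrix_unit S (U j))) (matrix_unit (extend_type m j S') T) =
        (if S' = S then matrix_unit (extend_type m j S) T else 0)"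
      using type_coeff_matrix_unit[OF U[OF j] _ S] by auto
  qed
  then show ?thesis using S by (simp add: finite_types_like)
qed

lemma unbranch_in:
  assumes "j \<in> J"
  shows "unbranch c m T j (U j) g \<in> type_space c (Suc m) T"
  unfolding unbranch_def using extend_in[OF assms]
  by (intro comb.span_sum comb.span_scale comb.span_base) auto

text \<open>Together with \<open>sum_unbranch_branch\<close> these are the identities between
  injections and projections of a finite direct sum, from which bijectivity follows.\<close>

lemma branch_unbranch:
  assumes i: "i \<in> J" and j: "j \<in> J" and g: "g \<in> type_space c m (U i)"
  shows "branch c m T j (U j) (unbranch c m T i (U i) g) = (if i = j then g else 0)"
proof -
  have lin: "Vector_Spaces.linear cscale cscale (\<lambda>g. branch c m T j (U j) (unbranch c m T i (U i) g))"
    using Vector_Spaces.linear_compose[OF linear_unbranch linear_branch] by (simp add: o_def)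
  have lin': "Vector_Spaces.linear cscale cscale (\<lambda>g. if i = j then g else 0)"
    by (cases "i = j") (simp_all add: linear_ident linear_zero)
  show ?thesis
  proof (rule comb_pair.linear_eq_on[OF lin lin' g])
    fix b assume "b \<in> (\<lambda>S. matrix_unit S (U i)) ` types_like c m (U i)"
    then show "branch c m T j (U j) (unbranch c m T i (U i) b) = (if i = j then b else 0)"
      using i j by (auto simp: unbranch_matrix_unit branch_matrix_unit)
  qed
qed

lemma sum_unbranch_branch:
  assumes f: "f \<in> type_space c (Suc m) T"
  shows "(\<Sum>j\<in>J. unbranch c m T j (U j) (branch c m T j (U j) f)) = f"
proof -
  have lin: "Vector_Spaces.linear cscale cscale
      (\<lambda>f. \<Sum>j\<in>J. unbranch c m T j (U j) (branch c m T j (U j) f))"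
    using Vector_Spaces.linear_compose[OF linear_branch linear_unbranch]
    by (intro comb_pair.linear_compose_sum ballI) (simp add: o_def)
  show ?thesis
  proof (rule comb_pair.linear_eq_on[OF lin linear_ident f])
    fix b assume "b \<in> (\<lambda>S. matrix_unit S T) ` types_like c (Suc m) T"
    then obtain i S where i: "i \<in> J" and S: "S \<in> types_like c m (U i)"
      and b: "b = matrix_unit (extend_type m i S) T" by (auto elim: extend_exhaust)
    have "(\<Sum>j\<in>J. unbranch c m T j (U j) (branch c m T j (U j) b)) = (\<Sum>j\<in>J. if j = i then b else 0)"
      using i S comb_pair.linear_0[OF linear_unbranch]
      by (intro sum.cong refl) (auto simp: b branch_matrix_unit unbranch_matrix_unit)
    then show "(\<Sum>j\<in>J. unbranch c m T j (U j) (branch c m T j (U j) b)) = b"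
      using i finite_J by simp
  qed
qed

text \<open>An embedded matrix unit changes the old vertices of a row and keeps the label of the
  last one, so it commutes with forgetting that vertex.\<close>

lemma branch_equivariant:
  assumes g: "g \<in> diagram_carrier c m" and f: "f \<in> type_space c (Suc m) T" and j: "j \<in> J"
  shows "branch c m T j (U j) (comb_mult (embedding c m g) f) = comb_mult g (branch c m T j (U j) f)"
proof (rule bilinear_eq_on[OF g[unfolded diagram_carrier_span] f])
  fix a b assume "a \<in> matrix_units c m" "b \<in> (\<lambda>S. matrix_unit S T) ` types_like c (Suc m) T"
  then obtain P Q i S where a: "a = matrix_unit P Q" "P \<in> colour_types c m" "Q \<in> colour_types c m"
      "same_shape P Q" and i: "i \<in> J" and S: "S \<in> types_like c m (U i)"
      and b: "b = matrix_unit (extend_type m i S) T" by (auto elim: extend_exhaust)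
  have Sc: "S \<in> colour_types c m" "same_shape S (U i)" using S by (auto simp: types_like_def)
  have "comb_mult (embedding c m a) b = (if Q = S then matrix_unit (extend_type m i P) T else 0)"
    unfolding a(1) b using a Sc T J_le[OF i] extend_in[OF i S]
    by (intro embedding_matrix_unit_mult) (auto simp: types_like_def)
  moreover have "P \<in> types_like c m (U i)" if "Q = S"
    using that a Sc by (auto simp: types_like_def intro: same_shape_trans)
  moreover have "comb_mult a (branch c m T j (U j) b) = (if i = j \<and> Q = S then matrix_unit P (U j) else 0)"
    unfolding b branch_matrix_unit[OF i j S] using a Sc U[OF i]
    by (auto simp: matrix_unit_mult[of _ c m])
  ultimately show "branch c m T j (U j) (comb_mult (embedding c m a) b) =
      comb_mult a (branch c m T j (U j) b)"
    using i j comb_pair.linear_0[OF linear_branch] by (auto simp: branch_matrix_unit)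
qed (use Vector_Spaces.linear_compose[OF linear_embedding linear_comb_mult_left]
    Vector_Spaces.linear_compose[OF Vector_Spaces.linear_compose[OF linear_embedding linear_comb_mult_left] linear_branch]
    Vector_Spaces.linear_compose[OF linear_comb_mult_right linear_branch]
    Vector_Spaces.linear_compose[OF linear_branch linear_comb_mult_right]
    linear_comb_mult_left in \<open>simp_all add: o_def\<close>)

lemma isomorphic_branching:
  "isomorphic_modules (diagram_algebra c m)
     (restrict_scalars (embedding c m) (module_of_type c (Suc m) T))
     (direct_sum J (\<lambda>j. module_of_type c m (U j)))"
proof -
  let ?M = "restrict_scalars (embedding c m) (module_of_type c (Suc m) T)"
  let ?N = "direct_sum J (\<lambda>j. module_of_type c m (U j))"
  have left: "left_module (diagram_algebra c m) ?M"
    by (rule left_module_restrict_scalars[OF left_module_of_type[OF T] ring_diagram_algebra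
          embedding_ring_hom])
  have comp: "left_module (diagram_algebra c m) (module_of_type c m (U j))" if "j \<in> J" for j
    by (rule left_module_of_type[OF U[OF that]])
  have right: "left_module (diagram_algebra c m) ?N"
    by (rule left_module_direct_sum[OF ring_diagram_algebra comp])
  have M: "carrier ?M = type_space c (Suc m) T" "add ?M = (+)"
    by (simp_all add: restrict_scalars_def carrier_module_of_type[OF T])
  \<comment> \<open>\<open>J\<close> is finite, so finite support is automatic and the sum is the
    full product.\<close>
  have N: "carrier ?N = (\<Pi>\<^sub>E j\<in>J. type_space c m (U j))"
    using finite_J U
    by (auto simp: carrier_direct_sum[of J, OF comp] carrier_module_of_type intro!: PiE_cong)
  let ?h = "\<lambda>f. \<lambda>j\<in>J. branch c m T j (U j) f"
  let ?g = "\<lambda>w. \<Sum>j\<in>J. unbranch c m T j (U j) (w j)"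
  have "bij_betw ?h (type_space c (Suc m) T) (\<Pi>\<^sub>E j\<in>J. type_space c m (U j))"
  proof (rule bij_betw_byWitness[where f' = ?g])
    show "\<forall>f\<in>type_space c (Suc m) T. ?g (?h f) = f"
      using sum_unbranch_branch by simp
    show "\<forall>w\<in>\<Pi>\<^sub>E j\<in>J. type_space c m (U j). ?h (?g w) = w"
    proof
      fix w assume w: "w \<in> (\<Pi>\<^sub>E j\<in>J. type_space c m (U j))"
      have "branch c m T j (U j) (?g w) = w j" if j: "j \<in> J" for j
      proof -
        have "branch c m T j (U j) (?g w) = (\<Sum>i\<in>J. if i = j then w i else 0)"
          unfolding comb_pair.linear_sum[OF linear_branch]
          using w j by (intro sum.cong refl) (auto simp: branch_unbranch PiE_iff)
        then show ?thesis using j finite_J by simp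
      qed
      then show "?h (?g w) = w"
        using w by (intro extensionalityI[of _ J]) (auto simp: PiE_def)
    qed
    show "?h ` type_space c (Suc m) T \<subseteq> (\<Pi>\<^sub>E j\<in>J. type_space c m (U j))"
      by (auto simp: branch_in)
    show "?g ` (\<Pi>\<^sub>E j\<in>J. type_space c m (U j)) \<subseteq> type_space c (Suc m) T"
      by (intro image_subsetI comb.span_sum unbranch_in)
  qed
  moreover have "?h \<in> hom (add_monoid ?M) (add_monoid ?N)"
    using M N by (intro homI) (auto simp: branch_in comb_pair.linear_add[OF linear_branch] fun_eq_iff)
  ultimately have "?h \<in> iso (add_monoid ?M) (add_monoid ?N)"
    using M N by (simp add: iso_def)
  moreover have "\<forall>a\<in>carrier (diagram_algebra c m). \<forall>x\<in>carrier ?M.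
      ?h (a \<odot>\<^bsub>?M\<^esub> x) = a \<odot>\<^bsub>?N\<^esub> ?h x"
    unfolding M by (auto simp: restrict_scalars_def branch_equivariant fun_eq_iff)
  ultimately show ?thesis
    unfolding isomorphic_modules_def by (intro conjI left right bexI[of _ ?h])
qed

end

section \<open>The branching rule for the chosen representatives\<close>

lemma irrep_branching:
  assumes ns: "ns \<in> compositions c (Suc m)"
  shows "decomposes_into_irreducibles (diagram_algebra c m)
    (restrict_scalars (embedding c m) (irrep c (Suc m) ns)) {j. j \<le> c \<and> ns j \<noteq> 0}
    (\<lambda>j. irrep c m (ns(j := ns j - 1)))"
proof -
  let ?T = "rep_type c (Suc m) ns" and ?U = "\<lambda>j. rep_type c m (ns(j := ns j - 1))"
  let ?J = "{j. j \<le> c \<and> ns j \<noteq> 0}"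
  have T: "?T \<in> colour_types c (Suc m)" "\<And>i. card (?T i) = ns i"
    using rep_type_in[OF ns] by (auto simp: types_of_def)
  have U: "?U j \<in> types_of c m (ns(j := ns j - 1))" if "j \<in> ?J" for j
    using that by (intro rep_type_in composition_decrease[OF ns]) auto
  have "branching c m ?T ?U ?J"
  proof
    show "?J = {j. j \<le> c \<and> ?T j \<noteq> {}}"
      using T colour_types_finite[OF T(1)] by (auto simp flip: T(2))
    fix j assume j: "j \<in> ?J"
    show Uc: "?U j \<in> colour_types c m" using U[OF j] by (simp add: types_of_def)
    \<comment> \<open>Adding one vertex to class \<open>j\<close> undoes the subtraction in
      \<open>ns j - 1\<close>, which is not truncated because \<open>ns j\<close> is nonzero on
      \<open>?J\<close>.\<close>
    show "same_shape (extend_type m j (?U j)) ?T"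
      unfolding same_shape_def card_extend_type[OF Uc] T(2)
      using U[OF j] j by (auto simp: types_of_def)
  qed (rule T(1))
  then have "isomorphic_modules (diagram_algebra c m)
      (restrict_scalars (embedding c m) (irrep c (Suc m) ns))
      (direct_sum ?J (\<lambda>j. irrep c m (ns(j := ns j - 1))))"
    unfolding irrep_rep_type by (rule branching.isomorphic_branching)
  then show ?thesis
    unfolding decomposes_into_irreducibles_def
    using irreducible_irrep[OF composition_decrease[OF ns]] by auto
qed

text \<open>A nonzero vector fixed by \<open>?e\<close> is carried from the representative to
  \<open>N i\<close>, extended by zero to the direct sum and pulled back to the restricted module,
  where \<open>?e\<close> acts as the sum of the diagonal units of its extensions.\<close>

lemma summand_decrease:
  assumes ns: "ns \<in> compositions c (Suc m)" and ms: "ms \<in> compositions c m"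
    and summand: "is_summand c m (irrep c m ms) (irrep c (Suc m) ns)"
  shows "\<exists>j\<le>c. ns j \<noteq> 0 \<and> ms = ns(j := ns j - 1)"
proof -
  let ?R = "diagram_algebra c m" and ?V = "restrict_scalars (embedding c m) (irrep c (Suc m) ns)"
  let ?S = "rep_type c m ms" and ?T = "rep_type c (Suc m) ns"
  have S: "?S \<in> colour_types c m" and T: "?T \<in> colour_types c (Suc m)"
    using ns ms by (auto intro: rep_type_colour)
  let ?e = "matrix_unit ?S ?S"
  from summand obtain I :: "nat set" and N :: "nat \<Rightarrow> (comb, comb) module" and i where
    irr: "\<And>k. k \<in> I \<Longrightarrow> irreducible_module ?R (N k)"
    and iso: "isomorphic_modules ?R ?V (direct_sum I N)"
    and i: "i \<in> I" and iso': "isomorphic_modules ?R (irrep c m ms) (N i)"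
    by (auto simp: is_summand_def decomposes_into_irreducibles_def)
  have N: "left_module ?R (N k)" if "k \<in> I" for k
    using irr[OF that] by (simp add: irreducible_module_def)
  have e: "?e \<in> carrier ?R" using S by (simp add: matrix_unit_in_carrier)
  have "?e \<in> type_space c m ?S"
    using types_like_refl[OF S] by (intro comb.span_base) auto
  then have "\<exists>y\<in>carrier (N i). y \<noteq> \<zero>\<^bsub>N i\<^esub> \<and> ?e \<odot>\<^bsub>N i\<^esub> y = y"
    using S matrix_unit_nonzero[OF S S]
    by (intro isomorphic_modules_fixed[OF iso' e, of ?e])
      (simp_all add: irrep_rep_type carrier_module_of_type matrix_unit_mult[of _ c m])
  then have "\<exists>z\<in>carrier (direct_sum I N). z \<noteq> \<zero>\<^bsub>direct_sum I N\<^esub> \<and> ?e \<odot>\<^bsub>direct_sum I N\<^esub> z = z"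
    using direct_sum_fixed[of I ?R N ?e i] N e i by blast
  then have "\<exists>v\<in>carrier ?V. v \<noteq> \<zero>\<^bsub>?V\<^esub> \<and> ?e \<odot>\<^bsub>?V\<^esub> v = v"
    using isomorphic_modules_fixed[OF isomorphic_modules_sym[OF iso] e] by blast
  then obtain v where v: "v \<in> type_space c (Suc m) ?T" "v \<noteq> 0" "comb_mult (embedding c m ?e) v = v"
    by (auto simp: restrict_scalars_def irrep_rep_type carrier_module_of_type[OF T])
  \<comment> \<open>Otherwise the extensions would meet no row of the column and \<open>?e\<close>
    would annihilate the vector \<open>v\<close> that it fixes.\<close>
  have "\<exists>j\<le>c. extend_type m j ?S \<in> types_like c (Suc m) ?T"
  proof (rule ccontr)
    assume no: "\<not> ?thesis"
    have "comb_mult (embedding c m ?e) b = 0"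
      if "b \<in> (\<lambda>S. matrix_unit S ?T) ` types_like c (Suc m) ?T" for b
    proof -
      from that obtain W where W: "W \<in> types_like c (Suc m) ?T" "b = matrix_unit W ?T" by blast
      then obtain j P where P: "j \<le> c" "P \<in> colour_types c m" "W = extend_type m j P"
        by (auto simp: types_like_def elim: extend_type_cases)
      then have "?S \<noteq> P" using no W by blast
      then show ?thesis
        using embedding_matrix_unit_mult[OF S S same_shape_refl P(2,1) T] W P
        by (simp add: types_like_def)
    qed
    then have "comb_mult (embedding c m ?e) v = 0"
      by (rule comb_pair.linear_eq_on[OF linear_comb_mult_right linear_zero v(1)])
    then show False using v by simp
  qed
  then obtain j where j: "j \<le> c" "extend_type m j ?S \<in> types_of c (Suc m) ns"
    using types_like_eq[OF rep_type_in[OF ns]] by auto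
  then have "ns j \<noteq> 0" "?S \<in> types_of c m (ns(j := ns j - 1))"
    using extend_type_in_types_of[OF S j(1)] by auto
  moreover have "?S \<in> types_of c m ms" by (rule rep_type_in[OF ms])
  ultimately have "ms = ns(j := ns j - 1)" by (auto simp: types_of_def fun_eq_iff)
  then show ?thesis using j(1) \<open>ns j \<noteq> 0\<close> by blast
qed

lemma summand_iff:
  assumes ns: "ns \<in> compositions c (Suc m)" and ms: "ms \<in> compositions c m"
  shows "is_summand c m (irrep c m ms) (irrep c (Suc m) ns) \<longleftrightarrow>
    (\<exists>j\<le>c. ns j \<noteq> 0 \<and> ms = ns(j := ns j - 1))"
proof
  assume "\<exists>j\<le>c. ns j \<noteq> 0 \<and> ms = ns(j := ns j - 1)"
  then obtain j where "j \<in> {j. j \<le> c \<and> ns j \<noteq> 0}" "ms = ns(j := ns j - 1)" by blast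
  moreover have "isomorphic_modules (diagram_algebra c m) (irrep c m ms) (irrep c m ms)"
    using irreducible_irrep[OF ms] by (simp add: irreducible_module_def isomorphic_modules_refl)
  ultimately show "is_summand c m (irrep c m ms) (irrep c (Suc m) ns)"
    unfolding is_summand_def using irrep_branching[OF ns]
    by (intro exI[of _ "{j. j \<le> c \<and> ns j \<noteq> 0}"] exI[of _ "\<lambda>j. irrep c m (ns(j := ns j - 1))"]) auto
qed (rule summand_decrease[OF assms])

section \<open>Vertices and edges of the Bratteli diagram\<close>

lemma vertices_iff:
  "(n, V) \<in> bratteli_vertices c \<longleftrightarrow> (\<exists>ns\<in>compositions c n. V = irrep c n ns)"
  by (auto simp: bratteli_vertices_def)

lemma bij_betw_vertices:
  "bij_betw (\<lambda>ns. (n, irrep c n ns)) (compositions c n) {v \<in> bratteli_vertices c. fst v = n}"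
  unfolding bij_betw_def
proof
  show "inj_on (\<lambda>ns. (n, irrep c n ns)) (compositions c n)"
    by (rule inj_onI) (auto dest: irrep_inject)
  show "(\<lambda>ns. (n, irrep c n ns)) ` compositions c n = {v \<in> bratteli_vertices c. fst v = n}"
    by (auto simp: vertices_iff)
qed

lemma edge_iff:
  assumes ns: "ns \<in> compositions c (Suc m)" and ms: "ms \<in> compositions c m"
  shows "{(Suc m, irrep c (Suc m) ns), (m, irrep c m ms)} \<in> bratteli_edges c \<longleftrightarrow>
    (\<exists>j\<le>c. ns j \<noteq> 0 \<and> ms = ns(j := ns j - 1))"
proof -
  have "{(Suc m, irrep c (Suc m) ns), (m, irrep c m ms)} \<in> bratteli_edges c \<longleftrightarrow>
      is_summand c m (irrep c m ms) (irrep c (Suc m) ns)"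
  proof
    assume "{(Suc m, irrep c (Suc m) ns), (m, irrep c m ms)} \<in> bratteli_edges c"
    \<comment> \<open>The level tags differ, so two such unordered pairs can be equal in one way
      only.\<close>
    then show "is_summand c m (irrep c m ms) (irrep c (Suc m) ns)"
      by (auto simp: bratteli_edges_def doubleton_eq_iff)
  next
    assume "is_summand c m (irrep c m ms) (irrep c (Suc m) ns)"
    then have "Suc m \<ge> 1 \<and> (Suc m, irrep c (Suc m) ns) \<in> bratteli_vertices c \<and>
        (Suc m - 1, irrep c m ms) \<in> bratteli_vertices c \<and>
        is_summand c (Suc m - 1) (irrep c m ms) (irrep c (Suc m) ns)"
      using ns ms by (auto simp: vertices_iff)
    then show "{(Suc m, irrep c (Suc m) ns), (m, irrep c m ms)} \<in> bratteli_edges c"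
      unfolding bratteli_edges_def
      by (intro CollectI exI[of _ "Suc m"] exI[of _ "irrep c (Suc m) ns"] exI[of _ "irrep c m ms"]) simp
  qed
  then show ?thesis using summand_iff[OF assms] by simp
qed

theorem mainTheorem3:
  fixes c :: nat
  assumes "c \<ge> 1"
  shows
    "(\<forall>n\<ge>1. \<forall>ns \<in> compositions c n.
        irreducible_module (diagram_algebra c n) (irrep c n ns) \<and>
        decomposes_into_irreducibles (diagram_algebra c (n - 1))
          (restrict_scalars (embedding c (n - 1)) (irrep c n ns))
          {j. j \<le> c \<and> ns j \<noteq> 0}
          (\<lambda>j. irrep c (n - 1) (ns(j := ns j - 1)))) \<and>
     (\<forall>n. bij_betw (\<lambda>ns. (n, irrep c n ns)) (compositions c n)
        {v \<in> bratteli_vertices c. fst v = n}) \<and>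
     (\<forall>n\<ge>1. \<forall>ns \<in> compositions c n. \<forall>ms \<in> compositions c (n - 1).
        {(n, irrep c n ns), (n - 1, irrep c (n - 1) ms)} \<in> bratteli_edges c \<longleftrightarrow>
        (\<exists>j\<le>c. ns j \<noteq> 0 \<and> ms = ns(j := ns j - 1))) \<and>
     (\<forall>n. \<forall>ns \<in> compositions c n.
        comb.dim (carrier (irrep c n ns)) = multinomial c ns)"
proof (intro conjI allI ballI impI)
  fix n ns assume "n \<ge> 1" "ns \<in> compositions c n"
  then obtain m where "n = Suc m" "ns \<in> compositions c (Suc m)" by (cases n) auto
  then show "decomposes_into_irreducibles (diagram_algebra c (n - 1))
      (restrict_scalars (embedding c (n - 1)) (irrep c n ns))
      {j. j \<le> c \<and> ns j \<noteq> 0} (\<lambda>j. irrep c (n - 1) (ns(j := ns j - 1)))"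
    using irrep_branching by simp
next
  fix n ns ms assume "n \<ge> 1" "ns \<in> compositions c n" "ms \<in> compositions c (n - 1)"
  then show "{(n, irrep c n ns), (n - 1, irrep c (n - 1) ms)} \<in> bratteli_edges c \<longleftrightarrow>
      (\<exists>j\<le>c. ns j \<noteq> 0 \<and> ms = ns(j := ns j - 1))"
    using edge_iff[of ns c "n - 1" ms] by (cases n) auto
qed (simp_all add: irreducible_irrep bij_betw_vertices dim_irrep)

end
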